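(* Let $q\in\mathbb C^\times$ be not a root of unity. The following identity holds in $U_q(L\mathfrak{sl}_2)[[z^{-1}]]$: $$\sum_{n=0}^\infty(-1)^nq^{n^2}E_0^{(n)}F_1^{(n)}K^{-n}z^{-n}=\sum_{\ell=0}^\infty(-1)^\ell q^{\ell^2}K^{-\ell}z^{-\ell}\cdot\mathcal P^+(q^{-2\ell}z)\,\big(F_1-q^{2\ell+2}F_2z^{-1}\big)^{(\ell)}\,E^+(q^{-2\ell}z)^{(\ell)}.$$
   Context: $U_q(L\mathfrak{sl}_2)$ is the unital $\mathbb C$-algebra generated by $E_k,F_k$ ($k\in\mathbb Z$), $\psi^\pm_{\pm\ell}$ ($\ell\ge0$), with convention $\psi^\pm_{\mp r}=0$ for $r\ge1$, and relations: all $\psi$'s commute, $\psi^+_0\psi^-_0=1$; $\psi^\pm_0E_k\psi^\mp_0=q^{\pm2}E_k$, $\psi^\pm_0F_k\psi_0^\mp=q^{\mp2}F_k$; for $\eta=\pm$ and $k\ge0$ if $\eta=+$, $k<0$ if $\eta=-$: $\psi^\eta_{k+1}E_l-q^2E_l\psi^\eta_{k+1}=q^2\psi^\eta_kE_{l+1}-E_{l+1}\psi^\eta_k$ and $\psi^\eta_{k+1}F_l-q^{-2}F_l\psi^\eta_{k+1}=q^{-2}\psi^\eta_kF_{l+1}-F_{l+1}\psi^\eta_k$; $E_{k+1}E_l-q^2E_lE_{k+1}=q^2E_kE_{l+1}-E_{l+1}E_k$ and $F_{k+1}F_l-q^{-2}F_lF_{k+1}=q^{-2}F_kF_{l+1}-F_{l+1}F_k$;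 $[E_k,F_l]=\frac{\psi^+_{k+l}-\psi^-_{k+l}}{q-q^{-1}}$. $K=\psi^+_0$. $\mathcal P^+(z)\in1+z^{-1}U_q(L\mathfrak{sl}_2)[[z^{-1}]]$ is the unique series in the subalgebra generated by the $\psi$'s with $\mathcal P^+(q^2z)=K^{-1}\psi^+(z)\,\mathcal P^+(z)$, where $\psi^+(z)=\sum_{n\ge0}\psi^+_nz^{-n}$. $E^+(z)=\sum_{n\ge0}E_nz^{-n}$. $[n]=\frac{q^n-q^{-n}}{q-q^{-1}}$, $[n]!=[n]\cdots[1]$, $x^{(n)}=x^n/[n]!$. *)

theory Defs
  imports Complex_Main "HOL-Library.Poly_Mapping" "HOL-Algebra.QuotRing" "HOL-Algebra.Generated_Rings"
begin

section \<open>Free associative algebras\<close>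

text \<open>
  The free monoid is written additively, because the convolution product on
  finitely supported functions is indexed by a \<^class>\<open>monoid_add\<close>.  The
  free unital \<open>\<complex>\<close>-algebra on \<open>'g\<close> is then the monoid algebra
  \<open>'g free_word \<Rightarrow>\<^sub>0 complex\<close>.
\<close>

datatype 'g free_word = Free_Word (letters: "'g list")

instantiation free_word :: (type) monoid_add
begin

definition zero_free_word :: "'a free_word" where
  "0 = Free_Word []"

definition plus_free_word :: "'a free_word \<Rightarrow> 'a free_word \<Rightarrow> 'a free_word" where
  "v + w = Free_Word (letters v @ letters w)"

instance
  by standard (simp_all add: zero_free_word_def plus_free_word_def)

end

type_synonym 'g free_alg = "'g free_word \<Rightarrow>\<^sub>0 complex"

definition gen :: "'g \<Rightarrow> 'g free_alg" where
  "gen g = Poly_Mapping.single (Free_Word [g]) 1"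

definition scalar :: "complex \<Rightarrow> 'g free_alg" where
  "scalar c = Poly_Mapping.single 0 c"

definition free_ring :: "'g free_alg ring" where
  "free_ring = \<lparr>carrier = UNIV, monoid.mult = (*), one = 1, zero = 0, add = (+)\<rparr>"

text \<open>
  The unital \<open>\<complex>\<close>-algebra presented by the relations \<open>r = 0\<close>, \<open>r \<in> R\<close>.
  (Ideals of \<^const>\<open>genideal\<close> and \<^const>\<open>FactRing\<close> are two-sided.)
\<close>

definition pres_cls :: "'g free_alg set \<Rightarrow> 'g free_alg \<Rightarrow> 'g free_alg set" where
  "pres_cls R x = (Idl\<^bsub>free_ring\<^esub> R) +>\<^bsub>free_ring\<^esub> x"

definition pres_alg :: "'g free_alg set \<Rightarrow> (complex, 'g free_alg set) module" where
  "pres_alg R = ring.extend (free_ring Quot (Idl\<^bsub>free_ring\<^esub> R))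
     (module.fields (\<lambda>c X. rcoset_mult free_ring (Idl\<^bsub>free_ring\<^esub> R) (pres_cls R (scalar c)) X))"


section \<open>The algebra \<open>U\<^sub>q(Lsl\<^sub>2)\<close>\<close>

text \<open>\<open>Gpsi_plus n\<close> and \<open>Gpsi_minus n\<close> stand for \<open>\<psi>\<^sup>+\<^sub>n\<close> and \<open>\<psi>\<^sup>-\<^sub>-\<^sub>n\<close>.\<close>

datatype Uq_gen = GE int | GF int | Gpsi_plus nat | Gpsi_minus nat

definition fE :: "int \<Rightarrow> Uq_gen free_alg" where "fE k = gen (GE k)"

definition fF :: "int \<Rightarrow> Uq_gen free_alg" where "fF k = gen (GF k)"

definition fpsi_plus :: "int \<Rightarrow> Uq_gen free_alg" where
  "fpsi_plus k = (if k \<ge> 0 then gen (Gpsi_plus (nat k)) else 0)"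

definition fpsi_minus :: "int \<Rightarrow> Uq_gen free_alg" where
  "fpsi_minus k = (if k \<le> 0 then gen (Gpsi_minus (nat (- k))) else 0)"

definition Uq_relations :: "complex \<Rightarrow> Uq_gen free_alg set" where
  "Uq_relations q =
     {a * b - b * a | a b. a \<in> range fpsi_plus \<union> range fpsi_minus \<and>
                           b \<in> range fpsi_plus \<union> range fpsi_minus}
   \<union> {fpsi_plus 0 * fpsi_minus 0 - 1}
   \<union> {fpsi_plus 0 * fE k * fpsi_minus 0 - scalar (q powi 2) * fE k | k. True}
   \<union> {fpsi_minus 0 * fE k * fpsi_plus 0 - scalar (q powi (-2)) * fE k | k. True}
   \<union> {fpsi_plus 0 * fF k * fpsi_minus 0 - scalar (q powi (-2)) * fF k | k. True}
   \<union> {fpsi_minus 0 * fF k * fpsi_plus 0 - scalar (q powi 2) * fF k | k. True}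
   \<union> {(psi (k + 1) * fE l - scalar (q powi 2) * (fE l * psi (k + 1)))
       - (scalar (q powi 2) * (psi k * fE (l + 1)) - fE (l + 1) * psi k) | psi k l.
        psi = fpsi_plus \<and> k \<ge> 0 \<or> psi = fpsi_minus \<and> k < 0}
   \<union> {(psi (k + 1) * fF l - scalar (q powi (-2)) * (fF l * psi (k + 1)))
       - (scalar (q powi (-2)) * (psi k * fF (l + 1)) - fF (l + 1) * psi k) | psi k l.
        psi = fpsi_plus \<and> k \<ge> 0 \<or> psi = fpsi_minus \<and> k < 0}
   \<union> {(fE (k + 1) * fE l - scalar (q powi 2) * (fE l * fE (k + 1)))
       - (scalar (q powi 2) * (fE k * fE (l + 1)) - fE (l + 1) * fE k) | k l. True}
   \<union> {(fF (k + 1) * fF l - scalar (q powi (-2)) * (fF l * fF (k + 1)))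
       - (scalar (q powi (-2)) * (fF k * fF (l + 1)) - fF (l + 1) * fF k) | k l. True}
   \<union> {(fE k * fF l - fF l * fE k)
       - scalar (1 / (q - inverse q)) * (fpsi_plus (k + l) - fpsi_minus (k + l)) | k l. True}"

definition Uq :: "complex \<Rightarrow> (complex, Uq_gen free_alg set) module" where
  "Uq q = pres_alg (Uq_relations q)"

definition Uq_E :: "complex \<Rightarrow> int \<Rightarrow> Uq_gen free_alg set" where
  "Uq_E q k = pres_cls (Uq_relations q) (fE k)"

definition Uq_F :: "complex \<Rightarrow> int \<Rightarrow> Uq_gen free_alg set" where
  "Uq_F q k = pres_cls (Uq_relations q) (fF k)"

definition Uq_psi_plus :: "complex \<Rightarrow> int \<Rightarrow> Uq_gen free_alg set" where
  "Uq_psi_plus q k = pres_cls (Uq_relations q) (fpsi_plus k)"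

definition Uq_psi_minus :: "complex \<Rightarrow> int \<Rightarrow> Uq_gen free_alg set" where
  "Uq_psi_minus q k = pres_cls (Uq_relations q) (fpsi_minus k)"

definition Uq_K :: "complex \<Rightarrow> Uq_gen free_alg set" where
  "Uq_K q = Uq_psi_plus q 0"


section \<open>Quantum factorials and divided powers\<close>

definition qint :: "complex \<Rightarrow> nat \<Rightarrow> complex" where
  "qint q n = (q powi int n - q powi (- int n)) / (q - inverse q)"

definition qfact :: "complex \<Rightarrow> nat \<Rightarrow> complex" where
  "qfact q n = (\<Prod>m = 1..n. qint q m)"

definition divpow :: "complex \<Rightarrow> (complex, 'a) module \<Rightarrow> 'a \<Rightarrow> nat \<Rightarrow> 'a" where
  "divpow q A x n = (1 / qfact q n) \<odot>\<^bsub>A\<^esub> (x [^]\<^bsub>A\<^esub> n)"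


section \<open>Formal power series in \<open>z\<^sup>-\<^sup>1\<close>\<close>

text \<open>A series in \<open>A[[z\<^sup>-\<^sup>1]]\<close> is a function \<open>f\<close> with \<open>f n\<close> the coefficient of \<open>z\<^sup>-\<^sup>n\<close>.\<close>

definition series_alg :: "('k, 'a) module \<Rightarrow> ('k, nat \<Rightarrow> 'a) module" where
  "series_alg A =
    \<lparr>carrier = {f. \<forall>n. f n \<in> carrier A},
     monoid.mult = (\<lambda>f g n. \<Oplus>\<^bsub>A\<^esub>i\<in>{..n}. f i \<otimes>\<^bsub>A\<^esub> g (n - i)),
     one = (\<lambda>n. if n = 0 then \<one>\<^bsub>A\<^esub> else \<zero>\<^bsub>A\<^esub>),
     zero = (\<lambda>n. \<zero>\<^bsub>A\<^esub>),
     add = (\<lambda>f g n. f n \<oplus>\<^bsub>A\<^esub> g n),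
     smult = (\<lambda>c f n. c \<odot>\<^bsub>A\<^esub> f n)\<rparr>"

text \<open>The monomial \<open>x z\<^sup>-\<^sup>m\<close>.\<close>

definition zmonom :: "('k, 'a) module \<Rightarrow> 'a \<Rightarrow> nat \<Rightarrow> nat \<Rightarrow> 'a" where
  "zmonom A x m = (\<lambda>n. if n = m then x else \<zero>\<^bsub>A\<^esub>)"

text \<open>The substitution \<open>f(c z)\<close>.\<close>

definition zscale :: "(complex, 'a) module \<Rightarrow> complex \<Rightarrow> (nat \<Rightarrow> 'a) \<Rightarrow> nat \<Rightarrow> 'a" where
  "zscale A c f = (\<lambda>n. (c powi (- int n)) \<odot>\<^bsub>A\<^esub> f n)"

text \<open>
  The formal sum \<open>\<Sum>\<^sub>\<ell> f \<ell>\<close> of a locally finite family of series: each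
  coefficient is the sum of the finitely many nonzero contributions.
\<close>

definition series_sum :: "('k, 'a) module \<Rightarrow> (nat \<Rightarrow> nat \<Rightarrow> 'a) \<Rightarrow> nat \<Rightarrow> 'a" where
  "series_sum A f = (\<lambda>n. \<Oplus>\<^bsub>A\<^esub>l\<in>{l. f l n \<noteq> \<zero>\<^bsub>A\<^esub>}. f l n)"


section \<open>The series \<open>\<psi>\<^sup>+\<close>, \<open>E\<^sup>+\<close> and \<open>P\<^sup>+\<close>\<close>

abbreviation Uq_series :: "complex \<Rightarrow> (complex, nat \<Rightarrow> Uq_gen free_alg set) module" where
  "Uq_series q \<equiv> series_alg (Uq q)"

definition psi_plus_series :: "complex \<Rightarrow> nat \<Rightarrow> Uq_gen free_alg set" where
  "psi_plus_series q = (\<lambda>n. Uq_psi_plus q (int n))"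

definition E_plus_series :: "complex \<Rightarrow> nat \<Rightarrow> Uq_gen free_alg set" where
  "E_plus_series q = (\<lambda>n. Uq_E q (int n))"

definition psi_subalg :: "complex \<Rightarrow> Uq_gen free_alg set set" where
  "psi_subalg q = generate_ring (Uq q)
     (range (\<lambda>c. c \<odot>\<^bsub>Uq q\<^esub> \<one>\<^bsub>Uq q\<^esub>) \<union> range (Uq_psi_plus q) \<union> range (Uq_psi_minus q))"

definition is_P_plus :: "complex \<Rightarrow> (nat \<Rightarrow> Uq_gen free_alg set) \<Rightarrow> bool" where
  "is_P_plus q P \<longleftrightarrow>
     (\<forall>n. P n \<in> psi_subalg q) \<and> P 0 = \<one>\<^bsub>Uq q\<^esub> \<and>
     zscale (Uq q) (q powi 2) P =
       zmonom (Uq q) (inv\<^bsub>Uq q\<^esub> Uq_K q) 0 \<otimes>\<^bsub>Uq_series q\<^esub> psi_plus_series q \<otimes>\<^bsub>Uq_series q\<^esub> P"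

definition P_plus :: "complex \<Rightarrow> nat \<Rightarrow> Uq_gen free_alg set" where
  "P_plus q = (THE P. is_P_plus q P)"


section \<open>Well-definedness of \<open>P\<^sup>+\<close>\<close>

lemma ring_free_ring: "ring (free_ring :: 'g free_alg ring)"
proof (rule ringI)
  show "abelian_group (free_ring :: 'g free_alg ring)"
  proof (rule abelian_groupI)
    fix x :: "'g free_alg"
    show "\<exists>y\<in>carrier free_ring. y \<oplus>\<^bsub>free_ring\<^esub> x = \<zero>\<^bsub>free_ring\<^esub>"
      by (rule bexI[of _ "- x"]) (simp_all add: free_ring_def)
  qed (simp_all add: free_ring_def add.assoc add.commute)
  show "monoid (free_ring :: 'g free_alg ring)"
    by (rule monoidI) (simp_all add: free_ring_def mult.assoc)
qed (simp_all add: free_ring_def algebra_simps)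

lemma ideal_pres: "ideal (Idl\<^bsub>free_ring\<^esub> R) free_ring"
  by (rule ring.genideal_ideal[OF ring_free_ring]) (simp add: free_ring_def)

lemma pres_alg_simps:
  "carrier (pres_alg R) = carrier (free_ring Quot (Idl\<^bsub>free_ring\<^esub> R))"
  "x \<otimes>\<^bsub>pres_alg R\<^esub> y = x \<otimes>\<^bsub>free_ring Quot (Idl\<^bsub>free_ring\<^esub> R)\<^esub> y"
  "x \<oplus>\<^bsub>pres_alg R\<^esub> y = x \<oplus>\<^bsub>free_ring Quot (Idl\<^bsub>free_ring\<^esub> R)\<^esub> y"
  "\<one>\<^bsub>pres_alg R\<^esub> = \<one>\<^bsub>free_ring Quot (Idl\<^bsub>free_ring\<^esub> R)\<^esub>"
  "\<zero>\<^bsub>pres_alg R\<^esub> = \<zero>\<^bsub>free_ring Quot (Idl\<^bsub>free_ring\<^esub> R)\<^esub>"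
  "c \<odot>\<^bsub>pres_alg R\<^esub> x = pres_cls R (scalar c) \<otimes>\<^bsub>pres_alg R\<^esub> x"
  by (simp_all add: pres_alg_def ring.defs module.defs FactRing_def)

lemma ring_pres_alg: "ring (pres_alg R)"
proof -
  interpret Q: ring "free_ring Quot (Idl\<^bsub>free_ring\<^esub> R)"
    by (rule ideal.quotient_is_ring[OF ideal_pres])
  show ?thesis
  proof (rule ringI)
    show "abelian_group (pres_alg R)"
    proof (rule abelian_groupI)
      fix x assume x: "x \<in> carrier (pres_alg R)"
      show "\<exists>y\<in>carrier (pres_alg R). y \<oplus>\<^bsub>pres_alg R\<^esub> x = \<zero>\<^bsub>pres_alg R\<^esub>"
        using x Q.l_neg Q.a_inv_closed unfolding pres_alg_simps by blast
    qed (simp_all add: pres_alg_simps Q.a_ac)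
    show "monoid (pres_alg R)"
      by (rule monoidI) (simp_all add: pres_alg_simps Q.m_assoc)
  qed (simp_all add: pres_alg_simps Q.l_distr Q.r_distr)
qed

lemma pres_cls_hom:
  "pres_cls R x \<in> carrier (pres_alg R)"
  "pres_cls R (x * y) = pres_cls R x \<otimes>\<^bsub>pres_alg R\<^esub> pres_cls R y"
  "pres_cls R (x + y) = pres_cls R x \<oplus>\<^bsub>pres_alg R\<^esub> pres_cls R y"
  "pres_cls R 1 = \<one>\<^bsub>pres_alg R\<^esub>"
proof -
  have h: "(\<lambda>x. (Idl\<^bsub>free_ring\<^esub> R) +>\<^bsub>free_ring\<^esub> x) \<in> ring_hom free_ring (free_ring Quot (Idl\<^bsub>free_ring\<^esub> R))"
    by (rule ideal.rcos_ring_hom[OF ideal_pres])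
  show "pres_cls R x \<in> carrier (pres_alg R)"
    using ring_hom_closed[OF h, of x] by (simp add: pres_cls_def pres_alg_simps free_ring_def)
  show "pres_cls R (x * y) = pres_cls R x \<otimes>\<^bsub>pres_alg R\<^esub> pres_cls R y"
    using ring_hom_mult[OF h, of x y] by (simp add: pres_cls_def pres_alg_simps free_ring_def)
  show "pres_cls R (x + y) = pres_cls R x \<oplus>\<^bsub>pres_alg R\<^esub> pres_cls R y"
    using ring_hom_add[OF h, of x y] by (simp add: pres_cls_def pres_alg_simps free_ring_def)
  show "pres_cls R 1 = \<one>\<^bsub>pres_alg R\<^esub>"
    using ring_hom_one[OF h] by (simp add: pres_cls_def pres_alg_simps free_ring_def)
qed

lemma pres_cls_zero: "pres_cls R 0 = \<zero>\<^bsub>pres_alg R\<^esub>"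
proof -
  interpret ring "pres_alg R" by (rule ring_pres_alg)
  show ?thesis
    using pres_cls_hom(3)[of R 0 0] pres_cls_hom(1)[of R 0] by (metis add.l_cancel_one add_0)
qed

lemma pres_cls_rel:
  assumes "x - y \<in> R"
  shows "pres_cls R x = pres_cls R y"
proof -
  interpret A: ring "pres_alg R" by (rule ring_pres_alg)
  interpret I: ideal "Idl\<^bsub>free_ring\<^esub> R" "free_ring" by (rule ideal_pres)
  have "R \<subseteq> Idl\<^bsub>free_ring\<^esub> R"
    by (rule ring.genideal_self[OF ring_free_ring]) (simp add: free_ring_def)
  hence "x - y \<in> Idl\<^bsub>free_ring\<^esub> R"
    using assms by auto
  hence "pres_cls R (x - y) = \<zero>\<^bsub>pres_alg R\<^esub>"
    by (simp add: pres_cls_def pres_alg_simps FactRing_def I.a_rcos_const)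
  moreover have "pres_cls R x = pres_cls R (x - y) \<oplus>\<^bsub>pres_alg R\<^esub> pres_cls R y"
    by (simp flip: pres_cls_hom(3))
  ultimately show ?thesis
    by (simp add: pres_cls_hom(1))
qed

lemma scalar_simps:
  "scalar (a * b) = scalar a * scalar b" "scalar (a + b) = scalar a + scalar b"
  "scalar 1 = 1" "scalar 0 = 0"
  by (simp_all add: scalar_def mult_single single_add)

lemma ring_Uq: "ring (Uq q)"
  by (simp add: Uq_def ring_pres_alg)

lemma smult_Uq:
  "c \<odot>\<^bsub>Uq q\<^esub> x = pres_cls (Uq_relations q) (scalar c) \<otimes>\<^bsub>Uq q\<^esub> x"
  by (simp add: Uq_def pres_alg_simps)

lemma scalar_carrier: "pres_cls (Uq_relations q) (scalar c) \<in> carrier (Uq q)"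
  by (simp add: Uq_def pres_cls_hom)

lemma Uq_K_inv:
  "inv\<^bsub>Uq q\<^esub> Uq_K q = Uq_psi_minus q 0" "inv\<^bsub>Uq q\<^esub> Uq_K q \<otimes>\<^bsub>Uq q\<^esub> Uq_K q = \<one>\<^bsub>Uq q\<^esub>"
proof -
  interpret U: ring "Uq q" by (rule ring_Uq)
  let ?R = "Uq_relations q"
  have "fpsi_plus 0 * fpsi_minus 0 - 1 \<in> ?R" by (auto simp: Uq_relations_def)
  hence 1: "Uq_K q \<otimes>\<^bsub>Uq q\<^esub> Uq_psi_minus q 0 = \<one>\<^bsub>Uq q\<^esub>"
    by (simp add: pres_cls_rel Uq_K_def Uq_psi_plus_def Uq_psi_minus_def Uq_def
             flip: pres_cls_hom)
  have "fpsi_plus 0 * fpsi_minus 0 - fpsi_minus 0 * fpsi_plus 0 \<in> ?R"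
    unfolding Uq_relations_def by (intro UnI1 CollectI) blast
  hence 2: "Uq_K q \<otimes>\<^bsub>Uq q\<^esub> Uq_psi_minus q 0 = Uq_psi_minus q 0 \<otimes>\<^bsub>Uq q\<^esub> Uq_K q"
    by (simp add: pres_cls_rel Uq_K_def Uq_psi_plus_def Uq_psi_minus_def Uq_def
             flip: pres_cls_hom)
  have c: "Uq_K q \<in> carrier (Uq q)" "Uq_psi_minus q 0 \<in> carrier (Uq q)"
    by (simp_all add: Uq_K_def Uq_psi_plus_def Uq_psi_minus_def Uq_def pres_cls_hom)
  show 3: "inv\<^bsub>Uq q\<^esub> Uq_K q = Uq_psi_minus q 0"
    using 1 2 c by (metis U.inv_char)
  show "inv\<^bsub>Uq q\<^esub> Uq_K q \<otimes>\<^bsub>Uq q\<^esub> Uq_K q = \<one>\<^bsub>Uq q\<^esub>"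
    using 1 2 3 by simp
qed

theorem ex1_P_plus:
  assumes q0: "q \<noteq> 0" and nru: "\<forall>n::nat. n > 0 \<longrightarrow> q ^ n \<noteq> 1"
  shows "\<exists>!P. is_P_plus q P"
proof -
  interpret U: ring "Uq q" by (rule ring_Uq)
  define H where "H = range (\<lambda>c. c \<odot>\<^bsub>Uq q\<^esub> \<one>\<^bsub>Uq q\<^esub>) \<union> range (Uq_psi_plus q) \<union> range (Uq_psi_minus q)"
  define s where "s c = pres_cls (Uq_relations q) (scalar c)" for c
  have s_closed [simp]: "s c \<in> carrier (Uq q)" for c
    by (simp add: s_def scalar_carrier)
  have s_mult: "s (a * b) = s a \<otimes>\<^bsub>Uq q\<^esub> s b" for a b
    by (simp add: s_def scalar_simps Uq_def pres_cls_hom)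
  have s_add: "s (a + b) = s a \<oplus>\<^bsub>Uq q\<^esub> s b" for a b
    by (simp add: s_def scalar_simps Uq_def pres_cls_hom)
  have s_one: "s 1 = \<one>\<^bsub>Uq q\<^esub>"
    by (simp add: s_def scalar_simps Uq_def pres_cls_hom)
  have smult: "c \<odot>\<^bsub>Uq q\<^esub> x = s c \<otimes>\<^bsub>Uq q\<^esub> x" for c x
    by (simp add: s_def smult_Uq)
  have psi_closed: "Uq_psi_plus q k \<in> carrier (Uq q)" "Uq_psi_minus q k \<in> carrier (Uq q)" for k
    by (simp_all add: Uq_psi_plus_def Uq_psi_minus_def Uq_def pres_cls_hom)
  have H: "H \<subseteq> carrier (Uq q)"
    by (auto simp: H_def smult psi_closed)
  have G: "psi_subalg q = generate_ring (Uq q) H"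
    by (simp add: psi_subalg_def H_def)
  have G_props: "\<zero>\<^bsub>Uq q\<^esub> \<in> psi_subalg q" "\<one>\<^bsub>Uq q\<^esub> \<in> psi_subalg q"
    "x \<in> psi_subalg q \<Longrightarrow> y \<in> psi_subalg q \<Longrightarrow> x \<oplus>\<^bsub>Uq q\<^esub> y \<in> psi_subalg q"
    "x \<in> psi_subalg q \<Longrightarrow> y \<in> psi_subalg q \<Longrightarrow> x \<otimes>\<^bsub>Uq q\<^esub> y \<in> psi_subalg q" for x y
    unfolding G by (auto intro: U.zero_in_generate generate_ring.intros)
  have G_carrier: "x \<in> carrier (Uq q)" if "x \<in> psi_subalg q" for x
    using that U.generate_ring_in_carrier[OF H] by (simp add: G)
  have s_G: "s c \<in> psi_subalg q" for c
  proof -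
    have "s c = c \<odot>\<^bsub>Uq q\<^esub> \<one>\<^bsub>Uq q\<^esub>" by (simp add: smult)
    thus ?thesis unfolding G H_def by (intro generate_ring.incl) blast
  qed
  define a where "a n = inv\<^bsub>Uq q\<^esub> Uq_K q \<otimes>\<^bsub>Uq q\<^esub> Uq_psi_plus q (int n)" for n
  have a_G: "a n \<in> psi_subalg q" for n
    unfolding a_def Uq_K_inv(1) G H_def by (intro generate_ring.eng_mult generate_ring.incl) blast+
  have a_closed [simp]: "a n \<in> carrier (Uq q)" for n
    by (rule G_carrier[OF a_G])
  have a0: "a 0 = \<one>\<^bsub>Uq q\<^esub>"
    using Uq_K_inv(2)[of q] by (simp add: a_def Uq_K_def)
  have inv_closed: "inv\<^bsub>Uq q\<^esub> Uq_K q \<in> carrier (Uq q)"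
    by (simp add: Uq_K_inv(1) psi_closed)

  have Kpsi: "zmonom (Uq q) (inv\<^bsub>Uq q\<^esub> Uq_K q) 0 \<otimes>\<^bsub>Uq_series q\<^esub> psi_plus_series q = a"
  proof
    fix n
    have "(zmonom (Uq q) (inv\<^bsub>Uq q\<^esub> Uq_K q) 0 \<otimes>\<^bsub>Uq_series q\<^esub> psi_plus_series q) n
        = (\<Oplus>\<^bsub>Uq q\<^esub>i\<in>{..n}. if 0 = i then a n else \<zero>\<^bsub>Uq q\<^esub>)"
      unfolding series_alg_def zmonom_def psi_plus_series_def
      by (simp, intro U.finsum_cong') (auto simp: a_def inv_closed psi_closed)
    also have "\<dots> = a n"
      by (subst U.finsum_singleton) auto
    finally show "(zmonom (Uq q) (inv\<^bsub>Uq q\<^esub> Uq_K q) 0 \<otimes>\<^bsub>Uq_series q\<^esub> psi_plus_series q) n = a n" .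
  qed

  define c where "c n = q powi (- (2 * int n)) - 1" for n
  have c0: "c n \<noteq> 0" if "n > 0" for n
  proof
    assume "c n = 0"
    hence "inverse (q powi int (2 * n)) = 1"
      by (simp add: c_def power_int_minus)
    hence "inverse (q ^ (2 * n)) = 1"
      by (simp only: power_int_of_nat)
    thus False using nru that by (metis inverse_eq_1_iff nat_0_less_mult_iff zero_less_numeral)
  qed
  define T where "T P n = (\<Oplus>\<^bsub>Uq q\<^esub>i\<in>{1..n}. if i \<in> {1..n} then a i \<otimes>\<^bsub>Uq q\<^esub> P (n - i) else \<zero>\<^bsub>Uq q\<^esub>)"
    for P n
  have T_closed: "T P n \<in> carrier (Uq q)" if "\<And>m. m < n \<Longrightarrow> P m \<in> carrier (Uq q)" for P n
    unfolding T_def using that by (intro U.finsum_closed) (auto intro!: U.m_closed)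

  have char: "is_P_plus q P \<longleftrightarrow> (\<forall>n. P n \<in> psi_subalg q) \<and> P 0 = \<one>\<^bsub>Uq q\<^esub> \<and>
      (\<forall>n>0. s (c n) \<otimes>\<^bsub>Uq q\<^esub> P n = T P n)" for P
  proof (cases "(\<forall>n. P n \<in> psi_subalg q) \<and> P 0 = \<one>\<^bsub>Uq q\<^esub>")
    case True
    have P [simp]: "P n \<in> carrier (Uq q)" for n
      using True G_carrier by blast
    have eq: "(a \<otimes>\<^bsub>Uq_series q\<^esub> P) n = T P n \<oplus>\<^bsub>Uq q\<^esub> P n" for n
    proof -
      have split: "{..n} = insert 0 {1..n}" by auto
      have "(a \<otimes>\<^bsub>Uq_series q\<^esub> P) n = (\<Oplus>\<^bsub>Uq q\<^esub>i\<in>{..n}. a i \<otimes>\<^bsub>Uq q\<^esub> P (n - i))"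
        by (simp add: series_alg_def)
      also have "\<dots> = P n \<oplus>\<^bsub>Uq q\<^esub> (\<Oplus>\<^bsub>Uq q\<^esub>i\<in>{1..n}. a i \<otimes>\<^bsub>Uq q\<^esub> P (n - i))"
        unfolding split by (subst U.finsum_insert) (auto simp: a0)
      also have "(\<Oplus>\<^bsub>Uq q\<^esub>i\<in>{1..n}. a i \<otimes>\<^bsub>Uq q\<^esub> P (n - i)) = T P n"
        unfolding T_def by (intro U.finsum_cong') auto
      finally show ?thesis
        by (simp add: U.a_comm T_closed)
    qed
    have "zscale (Uq q) (q powi 2) P n = (a \<otimes>\<^bsub>Uq_series q\<^esub> P) n \<longleftrightarrow>
          s (c n) \<otimes>\<^bsub>Uq q\<^esub> P n = T P n" for n
    proof -
      have "(q powi 2) powi (- int n) = c n + 1"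
        using power_int_mult[of q 2 "- int n"] by (simp add: c_def)
      hence "zscale (Uq q) (q powi 2) P n = s (c n) \<otimes>\<^bsub>Uq q\<^esub> P n \<oplus>\<^bsub>Uq q\<^esub> P n"
        by (simp add: zscale_def smult s_add s_one U.l_distr)
      thus ?thesis
        unfolding eq by (simp add: T_closed)
    qed
    moreover have "s (c 0) \<otimes>\<^bsub>Uq q\<^esub> P 0 = T P 0"
    proof -
      have "s 0 = \<zero>\<^bsub>Uq q\<^esub>"
        by (simp add: s_def scalar_simps pres_cls_zero Uq_def)
      thus ?thesis by (simp add: c_def T_def)
    qed
    ultimately show ?thesis
      using True unfolding is_P_plus_def Kpsi fun_eq_iff by (metis gr0I)
  next
    case False
    thus ?thesis by (auto simp: is_P_plus_def)
  qed

  have s_cancel: "s (1 / c n) \<otimes>\<^bsub>Uq q\<^esub> (s (c n) \<otimes>\<^bsub>Uq q\<^esub> x) = x"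
    "s (c n) \<otimes>\<^bsub>Uq q\<^esub> (s (1 / c n) \<otimes>\<^bsub>Uq q\<^esub> x) = x"
    if "n > 0" "x \<in> carrier (Uq q)" for n x
    using that c0[OF that(1)] by (simp_all add: s_one flip: U.m_assoc s_mult)

  have T_cong: "T P n = T P' n" if "\<And>m. m < n \<Longrightarrow> P m = P' m" for P P' n
  proof -
    have "(\<lambda>i. if i \<in> {1..n} then a i \<otimes>\<^bsub>Uq q\<^esub> P (n - i) else \<zero>\<^bsub>Uq q\<^esub>)
        = (\<lambda>i. if i \<in> {1..n} then a i \<otimes>\<^bsub>Uq q\<^esub> P' (n - i) else \<zero>\<^bsub>Uq q\<^esub>)"
      by (rule ext) (simp add: that)
    thus ?thesis by (simp only: T_def)
  qed

  define step where "step P n = (if n = 0 then \<one>\<^bsub>Uq q\<^esub> else s (1 / c n) \<otimes>\<^bsub>Uq q\<^esub> T P n)" for P n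
  define P where "P = wfrec less_than step"
  have P_rec: "P n = step P n" for n
  proof -
    have "P n = step (cut P less_than n) n"
      unfolding P_def by (rule wfrec) simp
    also have "\<dots> = step P n"
      using T_cong[of n "cut P less_than n" P] by (simp add: step_def cut_apply)
    finally show ?thesis .
  qed
  have P_G: "P n \<in> psi_subalg q" for n
  proof (induction n rule: less_induct)
    case (less n)
    have "T P n \<in> psi_subalg q"
    proof -
      have *: "(\<Oplus>\<^bsub>Uq q\<^esub>i\<in>A. f i) \<in> psi_subalg q"
        if "finite A" "\<And>i. i \<in> A \<Longrightarrow> f i \<in> psi_subalg q" for A :: "nat set" and f
        using that
      proof (induction A rule: finite_induct)
        case empty
        show ?case by (simp add: G_props)
      next
        case (insert x F)
        show ?case
          by (subst U.finsum_insert) (use insert in \<open>auto intro!: G_carrier G_props\<close>)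
      qed
      show ?thesis
        unfolding T_def by (rule *) (use less in \<open>auto intro!: G_props a_G\<close>)
    qed
    thus ?case
      by (subst P_rec) (auto simp: step_def intro!: G_props s_G)
  qed
  have "is_P_plus q P"
    unfolding char
  proof (intro conjI allI impI)
    show "P n \<in> psi_subalg q" for n by (rule P_G)
    show "P 0 = \<one>\<^bsub>Uq q\<^esub>" by (subst P_rec) (simp add: step_def)
    show "s (c n) \<otimes>\<^bsub>Uq q\<^esub> P n = T P n" if "n > 0" for n
      by (subst P_rec) (use that in \<open>simp add: step_def s_cancel T_closed G_carrier[OF P_G]\<close>)
  qed
  moreover have "Q = P" if Q: "is_P_plus q Q" for Q
  proof
    fix n show "Q n = P n"
    proof (induction n rule: less_induct)
      case (less n)
      show ?case
      proof (cases "n = 0")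
        case True
        thus ?thesis using Q P_rec[of 0] by (simp add: char step_def)
      next
        case False
        hence "s (c n) \<otimes>\<^bsub>Uq q\<^esub> Q n = T Q n" "Q n \<in> carrier (Uq q)"
          using Q G_carrier by (auto simp: char)
        hence "Q n = s (1 / c n) \<otimes>\<^bsub>Uq q\<^esub> T Q n"
          using False s_cancel(1)[of n "Q n"] by simp
        thus ?thesis
          using False T_cong[of n Q P] less P_rec[of n] by (simp add: step_def)
      qed
    qed
  qed
  ultimately show ?thesis by blast
qed

end

theory Submission
  imports Defs "HOL-Computational_Algebra.Formal_Power_Series"
begin

text \<open>
  Write \<open>L(z)\<close> for the left-hand side and \<open>R(z) = \<Sum>\<^sub>\<ell> R\<^sub>\<ell>(z)\<close> for the right-hand side.  From
  \<open>[n]\<^sup>2 L\<^sub>n = - q E\<^sub>0 L\<^sub>n\<^sub>-\<^sub>1 F\<^sub>1 K\<^sup>-\<^sup>1\<close> the series \<open>L\<close> is determined by a second order \<open>q\<close>-difference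
  equation.  That \<open>R\<close> satisfies it is seen by splitting it into two first order equations
  \<open>(q\<^sup>2 - 1) E\<^sub>0 R(z) = q\<^sup>2 S(q\<^sup>-\<^sup>2z) - S(z)\<close> and
  \<open>(q - q\<^sup>-\<^sup>1) z\<^sup>-\<^sup>1 S(z) F\<^sub>1 K\<^sup>-\<^sup>1 = R(q\<^sup>2z) - R(z)\<close>, where \<open>S\<close> is the companion series
  \<open>S(z) = \<Sum>\<^sub>\<ell> (-1)\<^sup>\<ell> q\<^bsup>\<ell>\<^sup>2+\<ell>\<^esup> K\<^sup>-\<^sup>\<ell> z\<^sup>-\<^sup>\<ell> P(q\<^bsup>-2\<ell>\<^esup>z) (F\<^sub>1 - q\<^bsup>2\<ell>+2\<^esup>F\<^sub>2z\<^sup>-\<^sup>1)\<^sup>(\<^sup>\<ell>\<^sup>) E(q\<^bsup>-2\<ell>\<^esup>z)\<^sup>(\<^sup>\<ell>\<^sup>+\<^sup>1\<^sup>)\<close>.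
  Both equations telescope in \<open>\<ell>\<close>, because the commutators of powers of \<open>a = E(z)\<close> with \<open>F\<^sub>1\<close>, and of
  powers of \<open>F\<^sub>1 - q\<^sup>2F\<^sub>2z\<^sup>-\<^sup>1\<close> with \<open>E(z) - q\<^sup>2E(q\<^sup>-\<^sup>2z)\<close>, collapse to powers of a single shifted element
  \<open>b\<close> (here \<open>b = E(q\<^sup>2z)\<close>), as a consequence of a quadratic relation between \<open>a\<close> and \<open>b\<close>.
\<close>

section \<open>Complex algebras and q-commutation\<close>

unbundle fps_syntax

text \<open>A type class, so that power series over such an algebra form an instance again and one
  calculus serves both coefficients and series.\<close>

class calg = ring_1 +
  fixes scaleC :: "complex \<Rightarrow> 'a \<Rightarrow> 'a" (infixr \<open>*\<^sub>C\<close> 73)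
  assumes scaleC_add_right: "c *\<^sub>C (x + y) = c *\<^sub>C x + c *\<^sub>C y"
    and scaleC_add_left: "(c + d) *\<^sub>C x = c *\<^sub>C x + d *\<^sub>C x"
    and scaleC_scaleC: "c *\<^sub>C d *\<^sub>C x = (c * d) *\<^sub>C x"
    and scaleC_one: "1 *\<^sub>C x = x"
    and scaleC_mult_left: "c *\<^sub>C x * y = c *\<^sub>C (x * y)"
    and scaleC_mult_right: "x * c *\<^sub>C y = c *\<^sub>C (x * y)"

global_interpretation calg: vector_space "scaleC :: complex \<Rightarrow> 'a \<Rightarrow> 'a::calg"
  by unfold_locales (simp_all add: scaleC_add_right scaleC_add_left scaleC_scaleC scaleC_one)

lemmas calg_simps = scaleC_mult_left scaleC_mult_right calg.scale_right_distrib
  calg.scale_right_diff_distrib calg.scale_minus_left calg.scale_minus_right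

lemma calg_mult_simps [simp]:
  fixes x y :: "'a::calg"
  shows "c *\<^sub>C x * y = c *\<^sub>C (x * y)" "x * c *\<^sub>C y = c *\<^sub>C (x * y)"
  by (simp_all add: scaleC_mult_left scaleC_mult_right)

instantiation fps :: (calg) calg
begin

definition scaleC_fps :: "complex \<Rightarrow> 'a fps \<Rightarrow> 'a fps" where
  "c *\<^sub>C f = Abs_fps (\<lambda>n. c *\<^sub>C f $ n)"

lemma scaleC_fps_nth [simp]: "(c *\<^sub>C f) $ n = c *\<^sub>C f $ n" for f :: "'a fps"
  by (simp add: scaleC_fps_def)

instance
  by standard
    (simp_all add: fps_eq_iff fps_mult_nth calg.scale_right_distrib calg.scale_left_distrib
      calg.scale_sum_right)

end

lemma commute_power:
  fixes x y :: "'a::calg"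
  assumes "x * y = c *\<^sub>C (y * x)"
  shows "x ^ n * y = c ^ n *\<^sub>C (y * x ^ n)"
proof (induction n)
  case (Suc n)
  have "x ^ Suc n * y = x * (x ^ n * y)"
    by (simp add: mult.assoc)
  also have "\<dots> = c ^ n *\<^sub>C ((x * y) * x ^ n)"
    by (simp add: Suc mult.assoc)
  also have "\<dots> = c ^ Suc n *\<^sub>C (y * x ^ Suc n)"
    by (simp add: assms mult.assoc mult.commute)
  finally show ?case .
qed simp

text \<open>The unnormalised quantum integer, written as a sum so that no division by
  \<open>1 - t\<close> occurs; \<open>geom_ti\<close> relates it to \<open>qint\<close>.\<close>

definition geom :: "complex \<Rightarrow> nat \<Rightarrow> complex" where
  "geom t n = (\<Sum>i<n. t ^ i)"

lemma geom_simps [simp]: "geom t 0 = 0" "geom t (Suc 0) = 1"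
  by (simp_all add: geom_def)

lemma geom_Suc: "geom t (Suc n) = geom t n + t ^ n"
  by (simp add: geom_def)

lemma geom_closed: "(1 - c) * geom c n = 1 - c ^ n"
proof (induction n)
  case (Suc n)
  show ?case
    unfolding geom_Suc distrib_left Suc by (simp add: algebra_simps)
qed simp

lemma geom_Suc': "geom t (Suc n) = 1 + t * geom t n"
  by (simp only: geom_def sum.lessThan_Suc_shift) (simp add: sum_distrib_left)

section \<open>Powers and commutators under a quadratic relation\<close>

context
  fixes a b :: "'a::calg" and t :: complex
  assumes ab: "a * a = (1 + t) *\<^sub>C (a * b) - t *\<^sub>C (b * b)"
begin

text \<open>The hypothesis \<open>ab\<close> says a(a - b) = t(a - b)b. Left multiplication by
  \<open>a\<close> thus preserves the shape of the right-hand side, and the coefficients obey the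
  recurrence with characteristic roots 1 and t.\<close>

lemma power_expand:
  "a ^ Suc n = geom t (Suc n) *\<^sub>C (a * b ^ n) - (t * geom t n) *\<^sub>C b ^ Suc n"
proof (induction n)
  case (Suc n)
  have ab': "a * (a * b ^ n) = (1 + t) *\<^sub>C (a * b ^ Suc n) - t *\<^sub>C b ^ Suc (Suc n)"
    by (simp add: ab calg_simps algebra_simps flip: mult.assoc)
  have "a ^ Suc (Suc n) = a * a ^ Suc n"
    by simp
  also have "\<dots> = geom t (Suc n) *\<^sub>C (a * (a * b ^ n)) - (t * geom t n) *\<^sub>C (a * b ^ Suc n)"
    unfolding Suc by (simp add: right_diff_distrib)
  also have "\<dots> = (geom t (Suc n) * (1 + t) - t * geom t n) *\<^sub>C (a * b ^ Suc n)
      - (t * geom t (Suc n)) *\<^sub>C b ^ Suc (Suc n)"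
    unfolding ab' by (simp add: calg_simps algebra_simps)
  also have "geom t (Suc n) * (1 + t) - t * geom t n = geom t (Suc (Suc n))"
    by (simp add: geom_Suc algebra_simps)
  finally show ?case .
qed simp

text \<open>The terms \<open>a * b ^ n\<close> cancel after \<open>power_expand\<close>. This
  combination arises when \<open>a\<close> is moved past \<open>psi\<close> in
  \<open>commutator_power\<close>.\<close>

lemma power_fold:
  "a ^ Suc n + geom t (Suc n) *\<^sub>C (((1 + t) *\<^sub>C b - a) * b ^ n) = geom t (Suc (Suc n)) *\<^sub>C b ^ Suc n"
proof -
  have "a ^ Suc n + geom t (Suc n) *\<^sub>C (((1 + t) *\<^sub>C b - a) * b ^ n)
      = (geom t (Suc n) * (1 + t) - t * geom t n) *\<^sub>C b ^ Suc n"
    unfolding power_expand by (simp add: calg_simps algebra_simps)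
  also have "geom t (Suc n) * (1 + t) - t * geom t n = geom t (Suc (Suc n))"
    by (simp add: geom_Suc algebra_simps)
  finally show ?thesis .
qed

text \<open>In the induction one factor \<open>a\<close> passes \<open>psi\<close> and
  \<open>k\<close> from the left; the \<open>psi\<close>-part collapses by
  \<open>power_fold\<close>, the \<open>k\<close>-part by \<open>geom_Suc'\<close>. The element
  \<open>X\<close> will be z^-1, which the commutator needs before it becomes a difference of
  \<open>psi\<close> and its constant term.\<close>

lemma commutator_power:
  assumes psi: "a * psi = psi * ((1 + t) *\<^sub>C b - a)"
    and k: "a * k = t *\<^sub>C (k * a)"
    and X: "X * a = a * X"
    and comm: "X * (a * y - y * a) = c *\<^sub>C (psi - k)"
  shows "X * (a ^ Suc n * y - y * a ^ Suc n)
    = (c * geom t (Suc n)) *\<^sub>C (psi * b ^ n - k * a ^ n)"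
proof (induction n)
  case 0
  then show ?case using comm by simp
next
  case (Suc n)
  have "X * (a ^ Suc (Suc n) * y - y * a ^ Suc (Suc n))
      = (X * a) * (a ^ Suc n * y - y * a ^ Suc n) + X * (a * y - y * a) * a ^ Suc n"
    by (simp add: algebra_simps)
  also have "\<dots> = a * (X * (a ^ Suc n * y - y * a ^ Suc n)) + c *\<^sub>C (psi - k) * a ^ Suc n"
    by (simp only: X mult.assoc comm)
  also have "\<dots> = (c * geom t (Suc n)) *\<^sub>C ((a * psi) * b ^ n - (a * k) * a ^ n) + c *\<^sub>C (psi - k) * a ^ Suc n"
    unfolding Suc by (simp add: right_diff_distrib mult.assoc)
  also have "\<dots> = c *\<^sub>C (psi * (a ^ Suc n + geom t (Suc n) *\<^sub>C (((1 + t) *\<^sub>C b - a) * b ^ n))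
      - (1 + t * geom t (Suc n)) *\<^sub>C (k * a ^ Suc n))"
    unfolding psi k by (simp add: calg_simps algebra_simps)
  also have "\<dots> = (c * geom t (Suc (Suc n))) *\<^sub>C (psi * b ^ Suc n - k * a ^ Suc n)"
    unfolding power_fold by (simp add: geom_Suc'[of t "Suc n"] calg_simps algebra_simps)
  finally show ?case .
qed

end

section \<open>Power series in the inverse of z\<close>

text \<open>
  The indeterminate \<open>fps_X\<close> stands for \<open>z\<^sup>-\<^sup>1\<close>.  Multiplication by the central element \<open>z\<^sup>-\<^sup>n\<close> is an
  operator of its own so that the simplifier can pull it out of products; likewise for scalars.
\<close>

definition ups :: "nat \<Rightarrow> 'a::calg fps \<Rightarrow> 'a fps" where
  "ups n f = fps_X ^ n * f"

lemma ups_nth: "ups n f $ m = (if m < n then 0 else f $ (m - n))"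
  by (simp add: ups_def fps_X_power_mult_nth)

lemma ups_simps [simp]:
  "ups n f * g = ups n (f * g)"
  "f * ups n g = ups n (f * g)"
  "ups n (ups m f) = ups (n + m) f"
  "c *\<^sub>C ups n f = ups n (c *\<^sub>C f)"
proof -
  show "f * ups n g = ups n (f * g)"
    by (metis ups_def mult.assoc fps_mult_fps_X_power_commute)
qed (simp_all add: ups_def mult.assoc power_add)

lemma ups_linear:
  "ups n (f + g) = ups n f + ups n g"
  "ups n (f - g) = ups n f - ups n g"
  "ups n (- f) = - ups n f"
  by (simp_all add: ups_def algebra_simps)

lemma ups_0 [simp]: "ups 0 f = f"
  by (simp add: ups_def)

text \<open>In terms of \<open>z\<close>, \<open>dil c f\<close> is \<open>f(z/c)\<close>.\<close>

definition dil :: "complex \<Rightarrow> 'a::calg fps \<Rightarrow> 'a fps" where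
  "dil c f = Abs_fps (\<lambda>n. c ^ n *\<^sub>C f $ n)"

lemma dil_nth [simp]: "dil c f $ n = c ^ n *\<^sub>C f $ n"
  by (simp add: dil_def)

lemma dil_mult: "dil c (f * g) = dil c f * dil c g"
  by (simp add: fps_eq_iff fps_mult_nth calg.scale_sum_right flip: power_add)

lemma dil_one: "dil c 1 = 1"
  by (simp add: fps_eq_iff)

lemma dil_power: "dil c (f ^ n) = dil c f ^ n"
  by (induction n) (simp_all add: dil_mult dil_one)

lemma dil_linear:
  "dil c (f + g) = dil c f + dil c g"
  "dil c (f - g) = dil c f - dil c g"
  "dil c (d *\<^sub>C f) = d *\<^sub>C dil c f"
  by (simp_all add: fps_eq_iff calg_simps mult.commute)

lemma dil_const: "dil c (fps_const x) = fps_const x"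
  by (simp add: fps_eq_iff)

lemma dil_ups: "dil c (ups n f) = c ^ n *\<^sub>C ups n (dil c f)"
  by (auto simp: fps_eq_iff ups_nth simp flip: power_add)

lemma dil_dil: "dil c (dil d f) = dil (c * d) f"
  by (simp add: fps_eq_iff power_mult_distrib)

lemma dil_1 [simp]: "dil 1 f = f"
  by (simp add: fps_eq_iff)

lemmas dil_simps = dil_mult dil_one dil_power dil_linear dil_const dil_ups dil_dil

text \<open>Lets products of two series in either order be summed over the index of the same
  series.\<close>

lemma fps_mult_nth_rev: "(f * g) $ n = (\<Sum>i=0..n. f $ (n - i) * g $ i)" for f :: "'a::ring_1 fps"
  unfolding fps_mult_nth by (subst sum.atLeastAtMost_rev) simp

lemma fps_const_scaleC: "c *\<^sub>C fps_const x = fps_const (c *\<^sub>C (x::'a::calg))"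
  by (simp add: fps_eq_iff)

declare fps_const_mult [simp del]

lemma dil_minus_const: "dil c f - fps_const (f $ 0) = c *\<^sub>C ups 1 (dil c (Abs_fps (\<lambda>k. f $ Suc k)))"
  by (auto simp: fps_eq_iff ups_nth simp flip: power_Suc)

text \<open>The two-variable relation between currents, restricted to arguments z/c and z/d: the
  mode relations are summed with weights c^i d^(n-i).\<close>

lemma current_relation:
  fixes G H :: "'a::calg fps"
  assumes rel: "\<And>k l. G $ Suc k * H $ l - t *\<^sub>C (H $ l * G $ Suc k)
    = t *\<^sub>C (G $ k * H $ Suc l) - H $ Suc l * G $ k"
  defines "G0 \<equiv> fps_const (G $ 0)" and "H0 \<equiv> fps_const (H $ 0)"
  shows "d *\<^sub>C ((dil c G - G0) * dil d H - t *\<^sub>C (dil d H * (dil c G - G0)))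
    = c *\<^sub>C (t *\<^sub>C (dil c G * (dil d H - H0)) - (dil d H - H0) * dil c G)"
proof -
  define G' H' where "G' = dil c (Abs_fps (\<lambda>k. G $ Suc k))" and "H' = dil d (Abs_fps (\<lambda>k. H $ Suc k))"
  have "G' * dil d H - t *\<^sub>C (dil d H * G') = t *\<^sub>C (dil c G * H') - H' * dil c G"
  proof (rule fps_ext)
    fix n
    have "(G' * dil d H - t *\<^sub>C (dil d H * G')) $ n
      = (\<Sum>i=0..n. (c ^ i * d ^ (n - i)) *\<^sub>C (G $ Suc i * H $ (n - i) - t *\<^sub>C (H $ (n - i) * G $ Suc i)))"
      unfolding G'_def
      by (simp add: fps_mult_nth[of "dil c _"] fps_mult_nth_rev[of "dil d _"] calg.scale_sum_right
          calg.scale_right_diff_distrib sum_subtractf mult_ac)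
    also have "\<dots> = (\<Sum>i=0..n. (c ^ i * d ^ (n - i)) *\<^sub>C
        (t *\<^sub>C (G $ i * H $ Suc (n - i)) - H $ Suc (n - i) * G $ i))"
      by (simp only: rel)
    also have "\<dots> = (t *\<^sub>C (dil c G * H') - H' * dil c G) $ n"
      unfolding H'_def
      by (simp add: fps_mult_nth[of "dil c _"] fps_mult_nth_rev[of "dil d _"] calg.scale_sum_right
          calg.scale_right_diff_distrib sum_subtractf mult_ac)
    finally show "(G' * dil d H - t *\<^sub>C (dil d H * G')) $ n = (t *\<^sub>C (dil c G * H') - H' * dil c G) $ n" .
  qed
  \<comment> \<open>Multiplication by c d z^-1 turns the shifted series into currents without their
    constant terms, by \<open>dil_minus_const\<close>.\<close>
  from arg_cong[OF this, of "\<lambda>x. (c * d) *\<^sub>C ups 1 x"] show ?thesis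
    unfolding G0_def H0_def dil_minus_const G'_def[symmetric] H'_def[symmetric]
    by (simp add: ups_linear calg_simps mult_ac)
qed

text \<open>By induction only \<open>Y $ n\<close> survives in coefficient n of
  \<open>W * Y\<close>, which leaves (c^n - 1) Y_n = 0. Serves as a uniqueness principle for
  difference equations.\<close>

lemma dil_fixed_zero:
  fixes W Y :: "'a::calg fps"
  assumes c: "\<And>n. n > 0 \<Longrightarrow> c ^ n \<noteq> 1"
    and W: "W $ 0 = 1" and Y: "Y $ 0 = 0" and eq: "dil c Y = W * Y"
  shows "Y = 0"
proof -
  have "Y $ n = 0" for n
  proof (induction n rule: less_induct)
    case (less n)
    show ?case
    proof (cases "n = 0")
      case False
      have "(W * Y) $ n = (\<Sum>i=0..n. if i = 0 then Y $ n else 0)"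
        unfolding fps_mult_nth using W less by (intro sum.cong) auto
      hence "(c ^ n - 1) *\<^sub>C Y $ n = 0"
        using arg_cong[OF eq, of "\<lambda>f. f $ n"] by (simp add: calg.scale_left_diff_distrib)
      with c False show ?thesis by (metis calg.scale_eq_0_iff eq_iff_diff_eq_0 gr0I)
    qed (simp add: Y)
  qed
  thus ?thesis by (simp add: fps_eq_iff)
qed

section \<open>The identity in an arbitrary algebra\<close>

text \<open>
  The relations among \<open>E\<^sub>n\<close> (\<open>n \<ge> 0\<close>), \<open>F\<^sub>1\<close>, \<open>F\<^sub>2\<close> and \<open>\<psi>\<^sup>+\<^sub>n\<close> on which the identity rests; \<open>\<psi>\<^sup>-\<close> drops out of
  \<open>[E\<^sub>k, F\<^sub>l]\<close> because \<open>k + l > 0\<close>.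
\<close>

locale half_loop =
  fixes q :: complex and E psi P :: "'a::calg fps" and F1 F2 K Ki :: 'a
  assumes q0: "q \<noteq> 0" and q_not_root: "\<And>n. n > 0 \<Longrightarrow> q ^ n \<noteq> 1"
    and K_Ki [simp]: "K * Ki = 1" "Ki * K = 1"
    and psi_0: "psi $ 0 = K"
    and psi_comm: "psi $ m * psi $ n = psi $ n * psi $ m"
    and P_psi: "P $ m * psi $ n = psi $ n * P $ m"
    and K_E: "K * E $ n = q\<^sup>2 *\<^sub>C (E $ n * K)"
    and F_K: "F1 * K = q\<^sup>2 *\<^sub>C (K * F1)" "F2 * K = q\<^sup>2 *\<^sub>C (K * F2)"
    and psi_E: "psi $ Suc k * E $ l - q\<^sup>2 *\<^sub>C (E $ l * psi $ Suc k)
      = q\<^sup>2 *\<^sub>C (psi $ k * E $ Suc l) - E $ Suc l * psi $ k"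
    and F_psi: "F1 * psi $ Suc k - q\<^sup>2 *\<^sub>C (psi $ Suc k * F1) = q\<^sup>2 *\<^sub>C (F2 * psi $ k) - psi $ k * F2"
    and E_E: "E $ Suc k * E $ l - q\<^sup>2 *\<^sub>C (E $ l * E $ Suc k)
      = q\<^sup>2 *\<^sub>C (E $ k * E $ Suc l) - E $ Suc l * E $ k"
    and F_F: "F1 * F2 = q\<^sup>2 *\<^sub>C (F2 * F1)"
    and E_F1: "E $ k * F1 - F1 * E $ k = (1 / (q - inverse q)) *\<^sub>C psi $ Suc k"
    and E_F2: "E $ k * F2 - F2 * E $ k = (1 / (q - inverse q)) *\<^sub>C psi $ Suc (Suc k)"
    and P_0: "P $ 0 = 1"
    and P_eq: "dil (inverse (q\<^sup>2)) P = fps_const Ki * psi * P"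
begin

abbreviation t where "t \<equiv> q\<^sup>2"
abbreviation ti where "ti \<equiv> inverse (q\<^sup>2)"

lemma t_pow: "n > 0 \<Longrightarrow> t ^ n \<noteq> 1"
  using q_not_root[of "2 * n"] by (simp add: power_mult)

lemma ti_pow: "n > 0 \<Longrightarrow> ti ^ n \<noteq> 1"
  using t_pow[of n] by (metis power_inverse inverse_eq_1_iff)

lemma t_1: "t \<noteq> 1"
  using t_pow[of 1] by simp

abbreviation k where "k \<equiv> fps_const K"
abbreviation ki where "ki \<equiv> fps_const Ki"
abbreviation f1 where "f1 \<equiv> fps_const F1"
abbreviation f2 where "f2 \<equiv> fps_const F2"
abbreviation e where "e n \<equiv> fps_const (E $ n)"

section \<open>Commutation with K and its inverse\<close>

lemma inverse_commute:
  assumes "x * K = c *\<^sub>C (K * x)" "c \<noteq> 0"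
  shows "x * Ki = inverse c *\<^sub>C (Ki * x)"
proof -
  have "Ki * (x * K) * Ki = Ki * (c *\<^sub>C (K * x)) * Ki"
    by (simp only: assms)
  hence "Ki * x = c *\<^sub>C (x * Ki)"
    by (simp add: mult.assoc) (simp flip: mult.assoc)
  thus ?thesis using assms(2) by simp
qed

lemma E_K: "E $ n * K = ti *\<^sub>C (K * E $ n)"
  using q0 by (simp add: K_E)

lemma commute_k:
  "psi * k = k * psi" "P * k = k * P" "E * k = ti *\<^sub>C (k * E)" "e n * k = ti *\<^sub>C (k * e n)"
  "f1 * k = t *\<^sub>C (k * f1)" "f2 * k = t *\<^sub>C (k * f2)"
  using psi_comm[of _ 0] P_psi[of _ 0]
  by (simp_all add: fps_eq_iff psi_0 F_K E_K)

lemma commute_ki: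
  "psi * ki = ki * psi" "P * ki = ki * P" "E * ki = t *\<^sub>C (ki * E)" "e n * ki = t *\<^sub>C (ki * e n)"
  "f1 * ki = ti *\<^sub>C (ki * f1)" "f2 * ki = ti *\<^sub>C (ki * f2)"
  using inverse_commute[of _ 1] psi_comm[of _ 0] P_psi[of _ 0] inverse_commute[OF E_K]
    inverse_commute[OF F_K(1)] inverse_commute[OF F_K(2)] q0
  by (simp_all add: fps_eq_iff psi_0)

lemma commute_psi_P: "psi * P = P * psi"
  by (simp add: fps_eq_iff fps_mult_nth[of psi] fps_mult_nth_rev[of P] P_psi)

text \<open>The current relation is used at equal arguments, for E(z) and for E(q^2 z), and once
  with the two arguments mixed; the boundary terms with \<open>e 0\<close> cancel.\<close>

lemma E_quadratic: "E * E = (1 + ti) *\<^sub>C (E * dil ti E) - ti *\<^sub>C (dil ti E * dil ti E)"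
proof -
  let ?B = "dil ti E"
  have 1: "(1 - t) *\<^sub>C (E * E) = e 0 * E - t *\<^sub>C (E * e 0)"
  proof -
    define Y where "Y = (1 - t) *\<^sub>C (E * E) - (e 0 * E - t *\<^sub>C (E * e 0))"
    \<comment> \<open>At equal arguments the two sides of the current relation are negatives of each
      other, so it yields twice the claim.\<close>
    have "Y + Y = 0"
      using current_relation[of E E t 1 1, OF E_E] unfolding Y_def
      by (simp add: calg_simps algebra_simps)
    hence "2 *\<^sub>C Y = 0"
      using calg.scale_left_distrib[of 1 1 Y] by simp
    thus ?thesis by (simp add: Y_def)
  qed
  have 2: "(1 - t) *\<^sub>C (?B * ?B) = e 0 * ?B - t *\<^sub>C (?B * e 0)"
    using arg_cong[OF 1, of "dil ti"] by (simp add: dil_simps)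
  have "ti *\<^sub>C ((E - e 0) * ?B - t *\<^sub>C (?B * (E - e 0))) = t *\<^sub>C (E * (?B - e 0)) - (?B - e 0) * E"
    using current_relation[of E E t ti 1, OF E_E] by simp
  hence "(ti - t) *\<^sub>C (E * ?B) = ti *\<^sub>C (e 0 * ?B - t *\<^sub>C (?B * e 0)) + (e 0 * E - t *\<^sub>C (E * e 0))"
    using q0 by (simp add: calg_simps algebra_simps)
  also have "\<dots> = (1 - t) *\<^sub>C (ti *\<^sub>C (?B * ?B) + E * E)"
    unfolding 1[symmetric] 2[symmetric] by (simp add: calg.scale_right_distrib mult.commute)
  also have "ti - t = (1 - t) * (1 + ti)"
    using q0 by (simp add: field_simps)
  finally have "(1 - t) *\<^sub>C ((1 + ti) *\<^sub>C (E * ?B)) = (1 - t) *\<^sub>C (ti *\<^sub>C (?B * ?B) + E * E)"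
    by simp
  from calg.scale_left_imp_eq[OF _ this] show ?thesis
    using t_1 by simp
qed

text \<open>The constant term K of \<open>psi\<close> drops out because it q-commutes with
  E.\<close>

lemma psi_E_current: "d *\<^sub>C (psi * dil d E) - (t * d) *\<^sub>C (dil d E * psi)
  = t *\<^sub>C (psi * (dil d E - e 0)) - (dil d E - e 0) * psi"
proof -
  have "k * dil d E = t *\<^sub>C (dil d E * k)"
    by (simp add: fps_eq_iff K_E mult_ac)
  thus ?thesis
    using current_relation[of psi E t d 1, OF psi_E]
    by (simp add: calg_simps algebra_simps psi_0)
qed

text \<open>At d = 1 and at d = \<open>ti\<close> the right-hand sides agree; at \<open>ti\<close>
  the terms with \<open>psi\<close> to the right of the current cancel.\<close>

lemma E_psi_exchange: "E * psi = psi * ((1 + ti) *\<^sub>C dil ti E - E)"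
proof -
  let ?B = "dil ti E"
  have 1: "(1 - t) *\<^sub>C (psi * E + E * psi) = e 0 * psi - t *\<^sub>C (psi * e 0)"
    using psi_E_current[of 1] by (simp add: calg_simps algebra_simps)
  have "(ti - t) *\<^sub>C (psi * ?B) = e 0 * psi - t *\<^sub>C (psi * e 0)"
    using psi_E_current[of ti] q0 by (simp add: calg_simps algebra_simps)
  also have "ti - t = (1 - t) * (1 + ti)"
    using q0 by (simp add: field_simps)
  finally have "(1 - t) *\<^sub>C ((1 + ti) *\<^sub>C (psi * ?B)) = (1 - t) *\<^sub>C (psi * E + E * psi)"
    unfolding 1 by simp
  from calg.scale_left_imp_eq[OF _ this] have "(1 + ti) *\<^sub>C (psi * ?B) = psi * E + E * psi"
    using t_1 by simp
  thus ?thesis by (simp add: right_diff_distrib)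
qed

text \<open>The base of the \<open>\<ell>\<close>-th divided power in the theorem is \<open>u (t ^ Suc \<ell>)\<close>.\<close>

definition u :: "complex \<Rightarrow> 'a fps" where
  "u c = f1 - c *\<^sub>C ups 1 f2"

lemma dil_u: "dil d (u c) = u (d * c)"
  by (simp add: u_def dil_simps mult.commute ups_linear)

lemma f1_f2: "f1 * f2 = t *\<^sub>C (f2 * f1)"
  by (simp add: fps_eq_iff F_F)

text \<open>The product depends only on t d + c and c d, and replacing (c, d) by (t d, c/t)
  preserves both.\<close>

lemma u_mult: "u c * u d = u (t * d) * u (ti * c)"
proof -
  have *: "u c * u d = f1 * f1 - (t * d + c) *\<^sub>C ups 1 (f2 * f1) + (c * d) *\<^sub>C ups 2 (f2 * f2)" for c d
    by (simp add: u_def algebra_simps f1_f2 ups_linear numeral_2_eq_2)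
  have "t * (ti * c) + t * d = t * d + c" "t * d * (ti * c) = c * d"
    using q0 by simp_all
  thus ?thesis by (simp only: *)
qed

text \<open>The last factor travels left by \<open>u_mult\<close>; each exchange turns a
  \<open>u (t * c)\<close> into \<open>u c\<close> and multiplies the travelling parameter by
  \<open>t\<close>.\<close>

lemma u_power_step: "u (t * c) ^ n * u (ti ^ n * c) = u c ^ Suc n"
proof (induction n)
  case (Suc n)
  have "u (t * c) ^ Suc n * u (ti ^ Suc n * c) = u (t * c) ^ n * (u (t * c) * u (ti ^ Suc n * c))"
    by (simp only: power_Suc2 mult.assoc)
  also have "u (t * c) * u (ti ^ Suc n * c) = u (ti ^ n * c) * u c"
    using u_mult[of "t * c" "ti ^ Suc n * c"] q0 by (simp add: field_simps)
  also have "u (t * c) ^ n * (u (ti ^ n * c) * u c) = u c ^ Suc (Suc n)"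
    using Suc by (simp add: mult.assoc[symmetric] power_Suc2 del: power_Suc)
  finally show ?case .
qed simp

lemma u_linear: "t *\<^sub>C u (ti * c) = (1 + t) *\<^sub>C u c - u (t * c)"
  using q0 by (simp add: u_def calg_simps algebra_simps ups_linear)

text \<open>\<open>u\<close> is affine in its parameter, so \<open>u (t * c)\<close> is a
  combination of \<open>u c\<close> and \<open>u (ti * c)\<close>; \<open>u_mult\<close> then turns
  \<open>u (t * c) * u (ti * c)\<close> into the square of \<open>u c\<close>.\<close>

lemma u_quadratic: "u (t * c) * u (t * c) = (1 + t) *\<^sub>C (u (t * c) * u c) - t *\<^sub>C (u c * u c)"
proof -
  have "u (t * c) * u (t * c) = u (t * c) * ((1 + t) *\<^sub>C u c - t *\<^sub>C u (ti * c))"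
    by (simp only: u_linear) (simp add: algebra_simps)
  thus ?thesis
    using u_mult[of c c] by (simp add: right_diff_distrib)
qed

text \<open>The relation \<open>F_psi\<close> summed over all modes, with \<open>F_K\<close> in
  degree 0; collecting the terms with \<open>psi\<close> on one side produces the parameters
  \<open>t\<close> and \<open>ti\<close>.\<close>

lemma u_psi: "u t * psi = t *\<^sub>C (psi * u ti)"
proof -
  have "f1 * psi - t *\<^sub>C (psi * f1) = t *\<^sub>C ups 1 (f2 * psi) - ups 1 (psi * f2)"
  proof (rule fps_ext)
    fix n
    show "(f1 * psi - t *\<^sub>C (psi * f1)) $ n = (t *\<^sub>C ups 1 (f2 * psi) - ups 1 (psi * f2)) $ n"
      by (cases n) (simp_all add: ups_nth psi_0 F_K F_psi)
  qed
  thus ?thesis using q0 by (simp add: u_def algebra_simps)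
qed

lemma u_k: "u c * k = t *\<^sub>C (k * u c)"
  by (simp add: u_def algebra_simps commute_k)

lemma u_ki: "u c * ki = ti *\<^sub>C (ki * u c)"
  by (simp add: u_def algebra_simps commute_ki)

section \<open>Commutators of E with F_1, F_2 and u\<close>

abbreviation h where "h \<equiv> 1 / (q - inverse q)"

lemma E_f1: "ups 1 (E * f1 - f1 * E) = h *\<^sub>C (psi - k)"
  by (auto simp: fps_eq_iff ups_nth E_F1 psi_0 gr0_conv_Suc)

lemma E_f2: "ups 2 (E * f2 - f2 * E) = h *\<^sub>C (psi - k - ups 1 (fps_const (psi $ 1)))"
proof (rule fps_ext)
  fix n
  show "ups 2 (E * f2 - f2 * E) $ n = (h *\<^sub>C (psi - k - ups 1 (fps_const (psi $ 1)))) $ n"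
    by (cases n; cases "n - 1") (simp_all add: ups_nth E_F2 psi_0)
qed

text \<open>The combination that \<open>P\<close> carries to a multiple of the single mode E_0, see
  \<open>e0_P\<close>. In its commutator with \<open>u t\<close> the terms with
  \<open>dil t psi\<close> and \<open>psi $ 1\<close> cancel.\<close>

definition E' where "E' = E - t *\<^sub>C dil t E"

lemma E'_u: "ups 1 (E' * u t - u t * E') = ((1 - t) * h) *\<^sub>C (psi - k)"
proof -
  let ?d = "dil t E" and ?c = "fps_const (psi $ 1)"
  have 1: "t *\<^sub>C ups 1 (?d * f1 - f1 * ?d) = h *\<^sub>C (dil t psi - k)"
    using arg_cong[OF E_f1, of "dil t"] by (simp add: dil_simps ups_linear calg_simps)
  have 2: "t\<^sup>2 *\<^sub>C ups 2 (?d * f2 - f2 * ?d) = h *\<^sub>C (dil t psi - k - t *\<^sub>C ups 1 ?c)"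
    using arg_cong[OF E_f2, of "dil t"] by (simp add: dil_simps ups_linear calg_simps)
  have "ups 1 (E' * u t - u t * E') = ups 1 (E * f1 - f1 * E) - t *\<^sub>C ups 1 (?d * f1 - f1 * ?d)
      - t *\<^sub>C ups 2 (E * f2 - f2 * E) + t\<^sup>2 *\<^sub>C ups 2 (?d * f2 - f2 * ?d)"
    by (simp add: E'_def u_def algebra_simps ups_linear numeral_2_eq_2 calg_simps)
  also have "\<dots> = ((1 - t) * h) *\<^sub>C (psi - k)"
    unfolding 1 2 E_f1 E_f2 by (simp add: algebra_simps calg_simps)
  finally show ?thesis .
qed

section \<open>Conjugation of the modes of E by psi and P\<close>

lemma psi_e: "psi * e n - t *\<^sub>C (e n * psi) = t *\<^sub>C ups 1 (psi * e (Suc n)) - ups 1 (e (Suc n) * psi)"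
proof (rule fps_ext)
  fix m
  show "(psi * e n - t *\<^sub>C (e n * psi)) $ m = (t *\<^sub>C ups 1 (psi * e (Suc n)) - ups 1 (e (Suc n) * psi)) $ m"
    by (cases m) (simp_all add: ups_nth psi_0 K_E psi_E)
qed

text \<open>Conjugation by K^-1 psi(z) multiplies E(w) by (1 - q^-2 x)/(1 - q^2 x) with x = w/z;
  here the denominator is cleared, so that only neighbouring modes occur.\<close>

lemma psi_e_pair: "ki * psi * (e n - t *\<^sub>C ups 1 (e (Suc n))) = (e n - ti *\<^sub>C ups 1 (e (Suc n))) * (ki * psi)"
proof -
  have "psi * (e n - t *\<^sub>C ups 1 (e (Suc n))) = (t *\<^sub>C e n - ups 1 (e (Suc n))) * psi"
    using psi_e[of n] by (simp add: algebra_simps)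
  hence "ki * psi * (e n - t *\<^sub>C ups 1 (e (Suc n))) = (ki * (t *\<^sub>C e n - ups 1 (e (Suc n)))) * psi"
    by (simp add: mult.assoc)
  also have "ki * (t *\<^sub>C e n - ups 1 (e (Suc n))) = (e n - ti *\<^sub>C ups 1 (e (Suc n))) * ki"
    using q0 by (simp add: algebra_simps commute_ki)
  finally show ?thesis by (simp add: mult.assoc)
qed

text \<open>
  Conjugating a current \<open>E(w)\<close> by \<open>P(z)\<close> multiplies it by \<open>g(w/z)\<close>, where \<open>g(x) = (1 - x)(1 - q\<^sup>2x)\<close> solves
  \<open>g(q\<^sup>-\<^sup>2x) / g(x) = (1 - q\<^sup>-\<^sup>2x) / (1 - q\<^sup>2x)\<close>, the factor picked up by \<open>\<psi>(z)\<close>.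
\<close>

lemma P_e: "P * e n = (e n - (1 + t) *\<^sub>C ups 1 (e (Suc n)) + t *\<^sub>C ups 2 (e (Suc (Suc n)))) * P"
proof -
  \<comment> \<open>With x = w/z, the families \<open>p\<close>, \<open>p'\<close> and
    \<open>r\<close> are the modes of E(w) multiplied by 1 - q^2 x, 1 - q^-2 x and g(x).\<close>
  define p where "p n = e n - t *\<^sub>C ups 1 (e (Suc n))" for n
  define p' where "p' n = e n - ti *\<^sub>C ups 1 (e (Suc n))" for n
  define r where "r n = p n - ups 1 (p (Suc n))" for n
  define W where "W = ki * psi"
  have W: "W * p n = p' n * W" for n
    unfolding W_def p_def p'_def by (rule psi_e_pair)
  have dil_r: "dil ti (r n) = p' n - ups 1 (p' (Suc n))"
    using q0 by (simp add: r_def p_def p'_def dil_simps ups_linear calg_simps algebra_simps power2_eq_square)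
  \<comment> \<open>The defect of the claim has no constant term and solves the same difference
    equation as \<open>P\<close>, so it vanishes by \<open>dil_fixed_zero\<close>.\<close>
  define Y where "Y = P * e n - r n * P"
  have "dil ti Y = W * P * e n - (p' n * W - ups 1 (p' (Suc n) * W)) * P"
    unfolding Y_def by (simp add: dil_simps P_eq W_def[symmetric] dil_r[unfolded dil_simps] algebra_simps)
  also have "\<dots> = W * Y"
    unfolding W[symmetric] by (simp add: Y_def r_def algebra_simps ups_linear)
  finally have "dil ti Y = W * Y" .
  hence "Y = 0"
    using ti_pow by (intro dil_fixed_zero[of ti W Y])
      (simp_all add: W_def Y_def r_def p_def ups_nth P_0 psi_0)
  thus ?thesis
    by (simp add: Y_def r_def p_def algebra_simps ups_linear numeral_2_eq_2 calg_simps)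
qed

text \<open>The relations \<open>P_e\<close> summed with weights c^n. As only nonnegative modes
  occur, shifts leave boundary terms in \<open>e 0\<close> and \<open>e 1\<close>; the factor c^2
  clears the denominators of the two shifts.\<close>

lemma P_dil_E:
  assumes "c \<noteq> 0"
  shows "c\<^sup>2 *\<^sub>C (P * dil c E) = (c\<^sup>2 *\<^sub>C dil c E - ((1 + t) * c) *\<^sub>C (dil c E - e 0)
    + t *\<^sub>C (dil c E - e 0 - c *\<^sub>C ups 1 (e 1))) * P"
proof -
  define D where "D j = dil c (Abs_fps (\<lambda>i. E $ (j + i)))" for j
  have D0: "D 0 = dil c E"
    by (simp add: D_def fps_nth_inverse)
  have D: "c *\<^sub>C ups 1 (D (Suc j)) = D j - e j" for j
    using dil_minus_const[of c "Abs_fps (\<lambda>i. E $ (j + i))"] by (simp add: D_def)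
  have "P * D 0 = D 0 * P - (1 + t) *\<^sub>C ups 1 (D 1 * P) + t *\<^sub>C ups 2 (D 2 * P)"
  proof (rule fps_ext)
    fix n
    have *: "P $ i * E $ j = E $ j * P $ i - (1 + t) *\<^sub>C (E $ Suc j * ups 1 P $ i)
      + t *\<^sub>C (E $ Suc (Suc j) * ups 2 P $ i)" for i j
      using arg_cong[OF P_e[of j], of "\<lambda>f. f $ i"]
      by (auto simp: algebra_simps ups_nth split: if_splits)
    have "(P * D 0) $ n = (\<Sum>i=0..n. c ^ i *\<^sub>C (P $ (n - i) * E $ i))"
      by (simp add: fps_mult_nth_rev D_def)
    also have "\<dots> = (\<Sum>i=0..n. c ^ i *\<^sub>C (E $ i * P $ (n - i)))
      - (1 + t) *\<^sub>C (\<Sum>i=0..n. c ^ i *\<^sub>C (E $ Suc i * ups 1 P $ (n - i)))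
      + t *\<^sub>C (\<Sum>i=0..n. c ^ i *\<^sub>C (E $ Suc (Suc i) * ups 2 P $ (n - i)))"
      unfolding * by (simp add: sum.distrib sum_subtractf calg.scale_right_distrib
          calg.scale_right_diff_distrib calg.scale_sum_right mult.commute)
    also have "\<dots> = (D 0 * P - (1 + t) *\<^sub>C (D 1 * ups 1 P) + t *\<^sub>C (D 2 * ups 2 P)) $ n"
      by (simp add: fps_mult_nth D_def del: ups_simps)
    finally show "(P * D 0) $ n = (D 0 * P - (1 + t) *\<^sub>C ups 1 (D 1 * P) + t *\<^sub>C ups 2 (D 2 * P)) $ n"
      by simp
  qed
  from arg_cong[OF this, of "scaleC (c\<^sup>2)"]
  have "c\<^sup>2 *\<^sub>C (P * D 0) = (c\<^sup>2 *\<^sub>C D 0 - ((1 + t) * c) *\<^sub>C (c *\<^sub>C ups 1 (D 1))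
      + t *\<^sub>C (c *\<^sub>C ups 1 (c *\<^sub>C ups 1 (D 2)))) * P"
    by (simp add: calg_simps algebra_simps power2_eq_square numeral_2_eq_2)
  also have "c *\<^sub>C ups 1 (D 1) = D 0 - e 0"
    using D[of 0] by simp
  also have "c *\<^sub>C ups 1 (D 2) = D 1 - e 1"
    using D[of 1] by (simp add: numeral_2_eq_2)
  also have "c *\<^sub>C ups 1 (D 1 - e 1) = D 0 - e 0 - c *\<^sub>C ups 1 (e 1)"
    using D[of 0] by (simp add: ups_linear calg.scale_right_diff_distrib)
  finally show ?thesis unfolding D0 .
qed

text \<open>In \<open>P_dil_E\<close> the coefficient of \<open>dil c E\<close> is (c - 1)(c - t),
  so at c = 1 and c = t only \<open>e 0\<close> and \<open>e 1\<close> remain; \<open>E'\<close> is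
  chosen to eliminate \<open>e 1\<close>.\<close>

lemma e0_P: "(1 - t) *\<^sub>C (e 0 * P) = P * E'"
proof -
  have 1: "P * E = e 0 * P - t *\<^sub>C ups 1 (e 1 * P)"
    using P_dil_E[of 1] by (simp add: algebra_simps calg_simps)
  have "t\<^sup>2 *\<^sub>C (P * dil t E) = t\<^sup>2 *\<^sub>C (e 0 * P - ups 1 (e 1 * P))"
    using P_dil_E[of t] q0 by (simp add: algebra_simps calg_simps power2_eq_square ups_linear)
  from calg.scale_left_imp_eq[OF _ this] have 2: "P * dil t E = e 0 * P - ups 1 (e 1 * P)"
    using q0 by simp
  show ?thesis
    unfolding E'_def right_diff_distrib calg_mult_simps 1 2 by (simp add: algebra_simps calg_simps ups_linear)
qed

text \<open>The scalar coefficients of \<open>R\<close> and of the companion series \<open>S\<close>.\<close>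

definition rho :: "nat \<Rightarrow> complex" where
  "rho n = (-1) ^ n * q ^ (n\<^sup>2) / (qfact q n)\<^sup>2"

definition theta :: "nat \<Rightarrow> complex" where
  "theta n = (-1) ^ n * q ^ (n\<^sup>2 + n) / (qfact q n * qfact q (Suc n))"

section \<open>Identities for the scalar coefficients\<close>

lemma qint_eq: "qint q n = (q ^ n - inverse q ^ n) / (q - inverse q)"
  by (simp add: qint_def power_int_minus power_inverse)

lemma q_minus_inverse: "q - inverse q \<noteq> 0"
  using t_1 q0 by (simp add: field_simps power2_eq_square)

lemma qint_nz: "n > 0 \<Longrightarrow> qint q n \<noteq> 0"
  using q_minus_inverse t_pow[of n] q0
  by (auto simp: qint_eq field_simps simp flip: power_add power_mult mult_2)

lemma qfact_Suc: "qfact q (Suc n) = qint q (Suc n) * qfact q n"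
  by (simp add: qfact_def)

lemma qfact_nz: "qfact q n \<noteq> 0"
  by (simp add: qfact_def qint_nz)

lemma geom_ti: "q ^ n * geom ti (Suc n) = qint q (Suc n)"
proof -
  have "(q - inverse q) * (q ^ n * geom ti (Suc n)) = q ^ Suc n * ((1 - ti) * geom ti (Suc n))"
    using q0 by (simp add: field_simps power2_eq_square)
  also have "\<dots> = q ^ Suc n * (1 - ti ^ Suc n)"
    unfolding geom_closed ..
  also have "\<dots> = q ^ Suc n - inverse q ^ Suc n"
    using q0 by (simp add: field_simps power2_eq_square power_mult_distrib)
  finally show ?thesis
    using q_minus_inverse by (simp add: qint_eq field_simps)
qed

text \<open>Turns the coefficient from \<open>E_power_f1\<close>, applied inside \<open>S\<close>,
  into that of \<open>R\<close>.\<close>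

lemma theta_geom: "theta n * geom ti (Suc n) = rho n"
proof -
  have "theta n * geom ti (Suc n) = (-1) ^ n * q ^ n\<^sup>2 * (q ^ n * geom ti (Suc n)) / (qfact q n * qfact q (Suc n))"
    by (simp add: theta_def power_add)
  thus ?thesis
    unfolding geom_ti qfact_Suc using qfact_nz[of n] qint_nz[of "Suc n"]
    by (simp add: rho_def power2_eq_square)
qed

lemma theta_rho: "(q - inverse q) * theta n = rho (Suc n) * (ti ^ Suc n - 1)"
proof -
  have 1: "ti ^ Suc n - 1 = - (inverse q ^ Suc n * ((q - inverse q) * qint q (Suc n)))"
    using q0 q_minus_inverse by (simp add: qint_eq field_simps power2_eq_square power_mult_distrib)
  have 2: "q ^ (Suc n)\<^sup>2 = q ^ (n\<^sup>2 + n) * q ^ Suc n"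
    by (simp add: power2_eq_square algebra_simps flip: power_add)
  show ?thesis
    unfolding 1 rho_def theta_def 2 qfact_Suc using qfact_nz[of n] qint_nz[of "Suc n"] q0
    by (auto simp: power2_eq_square power_inverse field_simps)
qed

lemma t_ti_pow: "t ^ n * ti ^ n = 1"
  using q0 by (simp add: power_inverse)

text \<open>Turns the coefficient from \<open>E'_u_power\<close>, applied inside
  \<open>R (Suc n)\<close>, into that of \<open>H n\<close>.\<close>

lemma geom_t: "(1 - t) * h * geom t (Suc n) * rho (Suc n) = t ^ Suc n * theta n"
proof -
  have "(q - inverse q) * (t ^ Suc n * theta n) = t ^ Suc n * (rho (Suc n) * (ti ^ Suc n - 1))"
    by (simp only: theta_rho[symmetric] mult_ac)
  also have "\<dots> = rho (Suc n) * (t ^ Suc n * ti ^ Suc n - t ^ Suc n)"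
    by (simp add: algebra_simps del: power_Suc)
  also have "\<dots> = rho (Suc n) * (1 - t ^ Suc n)"
    unfolding t_ti_pow ..
  also have "\<dots> = (q - inverse q) * ((1 - t) * h * geom t (Suc n) * rho (Suc n))"
    unfolding geom_closed[of t "Suc n", symmetric] using q_minus_inverse by simp
  finally show ?thesis
    by (simp only: mult_left_cancel[OF q_minus_inverse])
qed

text \<open>The recursion of the left-hand coefficients; t^n is the cost of moving F_1 past
  K^-n.\<close>

lemma rho_rec: "(1 - t ^ Suc n) * (ti ^ Suc n - 1) * rho (Suc n) = (q - inverse q) * (1 - t) * t ^ n * rho n"
proof -
  have "1 - t = - (t * (1 - ti))"
    using q0 by (simp add: right_diff_distrib)
  hence "t ^ n * ((1 - t) * geom ti (Suc n)) = - (t ^ Suc n * ((1 - ti) * geom ti (Suc n)))"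
    by simp
  also have "\<dots> = t ^ Suc n * ti ^ Suc n - t ^ Suc n"
    unfolding geom_closed by (simp add: right_diff_distrib del: power_Suc)
  also have "\<dots> = 1 - t ^ Suc n"
    unfolding t_ti_pow by simp
  finally have g: "1 - t ^ Suc n = t ^ n * ((1 - t) * geom ti (Suc n))" ..
  have "(1 - t ^ Suc n) * (ti ^ Suc n - 1) * rho (Suc n)
      = (1 - t ^ Suc n) * (rho (Suc n) * (ti ^ Suc n - 1))"
    by simp
  also have "\<dots> = (1 - t ^ Suc n) * ((q - inverse q) * theta n)"
    by (simp only: theta_rho)
  also have "\<dots> = (q - inverse q) * (1 - t) * t ^ n * (theta n * geom ti (Suc n))"
    unfolding g by simp
  finally show ?thesis
    unfolding theta_geom .
qed

section \<open>Dilated commutation rules\<close>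

abbreviation Ed where "Ed j \<equiv> dil (t ^ j) E"
abbreviation Pd where "Pd j \<equiv> dil (t ^ j) P"

lemma t_cancel: "t ^ Suc l * ti = t ^ l" "ti * t ^ Suc l = t ^ l"
proof -
  have 1: "t * ti = 1" and 2: "ti * t = 1"
    using q0 by simp_all
  show "t ^ Suc l * ti = t ^ l"
    by (simp only: power_Suc2 mult.assoc 1 mult_1_right)
  show "ti * t ^ Suc l = t ^ l"
    by (simp only: power_Suc mult.assoc[symmetric] 2 mult_1_left)
qed

lemma Ed_power_ki: "dil c E ^ n * ki = t ^ n *\<^sub>C (ki * dil c E ^ n)"
  by (rule commute_power) (use arg_cong[OF commute_ki(3), of "dil c"] in \<open>simp add: dil_simps\<close>)

lemma Pd_ki: "dil c P * ki = ki * dil c P" "dil c P * k = k * dil c P"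
  using arg_cong[OF commute_ki(2), of "dil c"] arg_cong[OF commute_k(2), of "dil c"]
  by (simp_all add: dil_simps)

lemma e0_ki_power: "e 0 * ki ^ n = t ^ n *\<^sub>C (ki ^ n * e 0)"
proof -
  have "ki * e 0 = ti *\<^sub>C (e 0 * ki)"
    using q0 by (simp add: commute_ki)
  from commute_power[OF this, of n] show ?thesis
    using q0 by (simp add: power_inverse)
qed

lemma ki_k [simp]: "ki * k = 1" "k * ki = 1" "ki * (k * f) = f" "k * (ki * f) = f"
  by (simp_all add: fps_const_mult fps_const_1_eq_1 flip: mult.assoc)

lemma u_power_ki: "u c ^ n * ki = ti ^ n *\<^sub>C (ki * u c ^ n)"
  by (rule commute_power) (rule u_ki)

lemma u_power_k: "u c ^ n * k = t ^ n *\<^sub>C (k * u c ^ n)"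
  by (rule commute_power) (rule u_k)

text \<open>The functional equation of \<open>P\<close>: a \<open>psi\<close> to its right is
  absorbed at the price of a factor \<open>k\<close> and of replacing z by q^2 z.\<close>

lemma Pd_psi: "dil c P * dil c psi = k * dil (c * ti) P"
proof -
  have "k * dil ti P = P * psi"
    by (simp add: P_eq mult.assoc commute_psi_P)
  from arg_cong[OF this, of "dil c"] show ?thesis
    by (simp add: dil_simps)
qed

lemma E_power_f1: "c *\<^sub>C ups 1 (dil c E ^ Suc n * f1 - f1 * dil c E ^ Suc n)
  = (h * geom ti (Suc n)) *\<^sub>C (dil c psi * dil (c * ti) E ^ n - k * dil c E ^ n)"
proof -
  have "fps_X * (E ^ Suc n * f1 - f1 * E ^ Suc n)
      = (h * geom ti (Suc n)) *\<^sub>C (psi * dil ti E ^ n - k * E ^ n)"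
    using E_f1
    by (intro commutator_power[OF E_quadratic E_psi_exchange commute_k(3) fps_mult_fps_X_commute])
      (simp add: ups_def)
  hence "ups 1 (E ^ Suc n * f1 - f1 * E ^ Suc n)
      = (h * geom ti (Suc n)) *\<^sub>C (psi * dil ti E ^ n - k * E ^ n)"
    by (simp add: ups_def)
  from arg_cong[OF this, of "dil c"] show ?thesis
    by (simp add: dil_simps del: power_Suc)
qed

text \<open>In \<open>commutator_power\<close> the powers are now those of \<open>u t\<close>, and
  \<open>E'\<close> plays the role of \<open>y\<close>; the reversed commutator accounts for the
  minus sign in \<open>comm\<close>.\<close>

lemma E'_u_power: "c *\<^sub>C ups 1 (dil c E' * u (c * t) ^ Suc n - u (c * t) ^ Suc n * dil c E')
  = ((1 - t) * h * geom t (Suc n)) *\<^sub>C (dil c psi * u c ^ n - k * u (c * t) ^ n)"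
proof -
  have quad: "u t * u t = (1 + t) *\<^sub>C (u t * u 1) - t *\<^sub>C (u 1 * u 1)"
    using u_quadratic[of 1] by simp
  have exch: "u t * psi = psi * ((1 + t) *\<^sub>C u 1 - u t)"
  proof -
    have "u t * psi = psi * (t *\<^sub>C u ti)"
      by (simp add: u_psi)
    thus ?thesis by (simp only: u_linear[of 1, unfolded mult_1_right])
  qed
  have comm: "fps_X * (u t * E' - E' * u t) = (- ((1 - t) * h)) *\<^sub>C (psi - k)"
    using arg_cong[OF E'_u, of uminus] by (simp add: ups_def algebra_simps)
  have "fps_X * (u t ^ Suc n * E' - E' * u t ^ Suc n)
      = (- ((1 - t) * h) * geom t (Suc n)) *\<^sub>C (psi * u 1 ^ n - k * u t ^ n)"
    by (rule commutator_power[OF quad exch u_k _ comm]) (rule fps_mult_fps_X_commute)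
  hence "ups 1 (E' * u t ^ Suc n - u t ^ Suc n * E')
      = ((1 - t) * h * geom t (Suc n)) *\<^sub>C (psi * u 1 ^ n - k * u t ^ n)"
    by (simp add: ups_def algebra_simps)
  from arg_cong[OF this, of "dil c"] show ?thesis
    by (simp add: dil_simps dil_u del: power_Suc)
qed

lemma u_power_psi: "u (c * t) ^ n * dil c psi = t ^ n *\<^sub>C (dil c psi * u (c * ti) ^ n)"
proof (induction n)
  case (Suc n)
  have 1: "u (c * t) * dil c psi = t *\<^sub>C (dil c psi * u (c * ti))"
    using arg_cong[OF u_psi, of "dil c"] by (simp add: dil_simps dil_u)
  have "u (c * t) ^ Suc n * dil c psi = u (c * t) ^ n * (u (c * t) * dil c psi)"
    by (simp only: power_Suc2 mult.assoc)
  also have "\<dots> = t *\<^sub>C ((u (c * t) ^ n * dil c psi) * u (c * ti))"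
    by (simp add: 1 mult.assoc)
  also have "\<dots> = t ^ Suc n *\<^sub>C (dil c psi * u (c * ti) ^ Suc n)"
    by (simp add: Suc mult.assoc power_commutes)
  finally show ?case .
qed simp

section \<open>The first order equation for S(z) F_1 K^-1\<close>

definition R where
  "R l = rho l *\<^sub>C ups l (ki ^ l * (Pd l * (u (t ^ Suc l) ^ l * Ed l ^ l)))"

definition S where
  "S l = theta l *\<^sub>C ups l (ki ^ l * (Pd l * (u (t ^ Suc l) ^ l * Ed l ^ Suc l)))"

text \<open>\<open>U l\<close> and \<open>V l\<close> are the terms of \<open>S_f1\<close> that do
  not belong to \<open>R l\<close>; \<open>U l\<close> and \<open>V (Suc l)\<close> recombine in
  \<open>U_V\<close>.\<close>

definition U where
  "U l = ((q - inverse q) * theta l) *\<^sub>C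
    ups (Suc l) (ki ^ Suc l * (Pd l * (u (t ^ Suc l) ^ l * (f1 * Ed l ^ Suc l))))"

definition V where
  "V l = rho l *\<^sub>C ups l (ki ^ l * (dil (t ^ l * ti) P * (u (t ^ l * ti) ^ l * dil (t ^ l * ti) E ^ l)))"

text \<open>\<open>u\<close> and \<open>E\<close> acquire inverse scalars when passing
  \<open>ki\<close>, so equal exponents cancel.\<close>

lemma ki_weight_zero: "u c ^ n * (dil d E ^ n * ki) = ki * (u c ^ n * dil d E ^ n)"
  using q0 by (simp add: Ed_power_ki power_inverse)
    (simp add: u_power_ki mult.assoc[symmetric] power_inverse)

lemma ki_weight_zero': "u c ^ n * (f1 * (dil d E ^ Suc n * ki)) = ki * (u c ^ n * (f1 * dil d E ^ Suc n))"
proof -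
  have "u c ^ n * (f1 * (dil d E ^ Suc n * ki)) = t ^ Suc n *\<^sub>C (u c ^ n * ((f1 * ki) * dil d E ^ Suc n))"
    by (simp only: Ed_power_ki) (simp add: mult.assoc del: power_Suc)
  also have "\<dots> = t ^ n *\<^sub>C ((u c ^ n * ki) * (f1 * dil d E ^ Suc n))"
    using q0 by (simp add: commute_ki mult.assoc)
  also have "\<dots> = ki * (u c ^ n * (f1 * dil d E ^ Suc n))"
    using q0 by (simp only: u_power_ki) (simp add: mult.assoc power_inverse)
  finally show ?thesis .
qed

text \<open>Moving \<open>f1\<close> left through the E-power gives \<open>U l\<close> and a
  commutator. Its \<open>psi\<close>-part passes the u-power and is absorbed by \<open>P\<close>,
  giving \<open>V l\<close>; its \<open>k\<close>-part cancels against the final \<open>ki\<close>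
  and gives \<open>R l\<close>.\<close>

lemma S_f1: "(q - inverse q) *\<^sub>C ups 1 (S l * f1 * ki) = U l + V l - R l"
proof -
  define A where "A = (\<lambda>x. ki ^ l * (Pd l * (u (t ^ Suc l) ^ l * (x * ki))))"
  have A_lin: "A (x + y) = A x + A y" "A (x - y) = A x - A y" "A (c *\<^sub>C x) = c *\<^sub>C A x" "A (ups n x) = ups n (A x)"
    for x y c n by (simp_all add: A_def algebra_simps)
  have E1: "ups 1 (Ed l ^ Suc l * f1) = ups 1 (f1 * Ed l ^ Suc l)
      + (ti ^ l * (h * geom ti (Suc l))) *\<^sub>C (dil (t ^ l) psi * dil (t ^ l * ti) E ^ l - k * Ed l ^ l)"
  proof -
    have "ups 1 (Ed l ^ Suc l * f1 - f1 * Ed l ^ Suc l)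
      = ti ^ l *\<^sub>C (t ^ l *\<^sub>C ups 1 (Ed l ^ Suc l * f1 - f1 * Ed l ^ Suc l))"
      using q0 by (simp add: power_inverse del: power_Suc ups_simps)
    also have "\<dots> = (ti ^ l * (h * geom ti (Suc l))) *\<^sub>C
        (dil (t ^ l) psi * dil (t ^ l * ti) E ^ l - k * Ed l ^ l)"
      by (simp only: E_power_f1 scaleC_scaleC)
    finally show ?thesis by (simp only: ups_linear diff_eq_eq add.commute)
  qed
  have psi: "A (dil (t ^ l) psi * dil (t ^ l * ti) E ^ l)
      = t ^ l *\<^sub>C (ki ^ l * (dil (t ^ l * ti) P * (u (t ^ l * ti) ^ l * dil (t ^ l * ti) E ^ l)))"
  proof -
    have "A (dil (t ^ l) psi * dil (t ^ l * ti) E ^ l)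
      = ki ^ l * (Pd l * ((u (t ^ l * t) ^ l * dil (t ^ l) psi) * (dil (t ^ l * ti) E ^ l * ki)))"
      by (simp add: A_def mult.assoc mult.commute[of t])
    also have "\<dots> = t ^ l *\<^sub>C (ki ^ l * ((Pd l * dil (t ^ l) psi) * (u (t ^ l * ti) ^ l * (dil (t ^ l * ti) E ^ l * ki))))"
      by (simp only: u_power_psi) (simp add: mult.assoc)
    also have "\<dots> = t ^ l *\<^sub>C (ki ^ l * (k * ((dil (t ^ l * ti) P * ki) * (u (t ^ l * ti) ^ l * dil (t ^ l * ti) E ^ l))))"
      by (simp only: ki_weight_zero Pd_psi mult.assoc)
    also have "\<dots> = t ^ l *\<^sub>C (ki ^ l * (dil (t ^ l * ti) P * (u (t ^ l * ti) ^ l * dil (t ^ l * ti) E ^ l)))"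
      by (simp only: Pd_ki mult.assoc ki_k)
    finally show ?thesis .
  qed
  have kk: "A (k * Ed l ^ l) = t ^ l *\<^sub>C (ki ^ l * (Pd l * (u (t ^ Suc l) ^ l * Ed l ^ l)))"
  proof -
    have "A (k * Ed l ^ l) = ki ^ l * (Pd l * ((u (t ^ Suc l) ^ l * k) * (Ed l ^ l * ki)))"
      by (simp only: A_def mult.assoc)
    also have "\<dots> = t ^ l *\<^sub>C (ki ^ l * (Pd l * (k * (u (t ^ Suc l) ^ l * (Ed l ^ l * ki)))))"
      by (simp only: u_power_k) (simp add: mult.assoc)
    also have "\<dots> = t ^ l *\<^sub>C (ki ^ l * (Pd l * (u (t ^ Suc l) ^ l * Ed l ^ l)))"
      by (simp only: ki_weight_zero ki_k)
    finally show ?thesis .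
  qed
  have f: "A (f1 * Ed l ^ Suc l) = ki ^ Suc l * (Pd l * (u (t ^ Suc l) ^ l * (f1 * Ed l ^ Suc l)))"
  proof -
    have "A (f1 * Ed l ^ Suc l) = ki ^ l * ((Pd l * ki) * (u (t ^ Suc l) ^ l * (f1 * Ed l ^ Suc l)))"
      by (simp only: A_def mult.assoc ki_weight_zero')
    thus ?thesis by (simp only: Pd_ki power_Suc2 mult.assoc)
  qed
  have "ups 1 (S l * f1 * ki) = theta l *\<^sub>C ups l (A (ups 1 (Ed l ^ Suc l * f1)))"
    by (simp add: S_def A_def mult.assoc del: power_Suc)
  also have "A (ups 1 (Ed l ^ Suc l * f1)) = ups 1 (ki ^ Suc l * (Pd l * (u (t ^ Suc l) ^ l * (f1 * Ed l ^ Suc l))))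
     + (ti ^ l * (h * geom ti (Suc l)) * t ^ l) *\<^sub>C
       (ki ^ l * (dil (t ^ l * ti) P * (u (t ^ l * ti) ^ l * dil (t ^ l * ti) E ^ l))
        - ki ^ l * (Pd l * (u (t ^ Suc l) ^ l * Ed l ^ l)))"
    unfolding E1 by (simp only: A_lin psi kk f) (simp only: scaleC_scaleC calg.scale_right_diff_distrib)
  also have "ti ^ l * (h * geom ti (Suc l)) * t ^ l = h * geom ti (Suc l)"
    using q0 by (simp add: power_inverse)
  finally have "(q - inverse q) *\<^sub>C ups 1 (S l * f1 * ki) = U l
    + ((q - inverse q) * theta l * (h * geom ti (Suc l))) *\<^sub>C ups l
       (ki ^ l * (dil (t ^ l * ti) P * (u (t ^ l * ti) ^ l * dil (t ^ l * ti) E ^ l))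
        - ki ^ l * (Pd l * (u (t ^ Suc l) ^ l * Ed l ^ l)))"
    by (simp add: U_def ups_linear calg_simps mult.assoc del: power_Suc)
  also have "(q - inverse q) * theta l * (h * geom ti (Suc l)) = rho l"
    using q_minus_inverse by (simp add: theta_geom[symmetric])
  finally show ?thesis
    by (simp add: V_def R_def ups_linear calg_simps del: power_Suc)
qed

text \<open>Up to a scalar, \<open>f1\<close> is the combination of \<open>u 1\<close> and
  \<open>u (t ^ Suc l)\<close> in which F_2 cancels. By \<open>u_power_step\<close> the
  \<open>u 1\<close> part becomes \<open>- V (Suc l)\<close>; the other part is the dilated
  \<open>R (Suc l)\<close>.\<close>

lemma U_V: "U l + V (Suc l) = dil ti (R (Suc l))"
proof -
  define A where "A = (\<lambda>x. ups (Suc l) (ki ^ Suc l * (Pd l * (x * Ed l ^ Suc l))))"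
  have A_lin: "A (x + y) = A x + A y" "A (x - y) = A x - A y" "A (c *\<^sub>C x) = c *\<^sub>C A x" for x y c
    by (simp_all add: A_def algebra_simps ups_linear)
  have "(t ^ Suc l - 1) *\<^sub>C f1 = t ^ Suc l *\<^sub>C u 1 - u (t ^ Suc l)"
    by (simp add: u_def calg_simps algebra_simps)
  hence "(t ^ Suc l - 1) *\<^sub>C (u (t ^ Suc l) ^ l * f1) = u (t ^ Suc l) ^ l * (t ^ Suc l *\<^sub>C u 1 - u (t ^ Suc l))"
    by (metis calg_mult_simps(2))
  also have "\<dots> = t ^ Suc l *\<^sub>C (u (t ^ Suc l) ^ l * u 1) - u (t ^ Suc l) ^ Suc l"
    by (simp add: right_diff_distrib power_commutes)
  also have "u (t ^ Suc l) ^ l * u 1 = u (t ^ l) ^ Suc l"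
    using u_power_step[of "t ^ l" l] q0 by (simp add: power_inverse)
  finally have *: "(t ^ Suc l - 1) *\<^sub>C (u (t ^ Suc l) ^ l * f1) = t ^ Suc l *\<^sub>C u (t ^ l) ^ Suc l - u (t ^ Suc l) ^ Suc l" .
  have "(q - inverse q) * theta l = - (rho (Suc l) * ti ^ Suc l) * (t ^ Suc l - 1)"
  proof -
    show ?thesis
      using t_ti_pow[of "Suc l"]
      unfolding theta_rho by (simp add: algebra_simps del: power_Suc)
  qed
  hence "U l = (- (rho (Suc l) * ti ^ Suc l)) *\<^sub>C A ((t ^ Suc l - 1) *\<^sub>C (u (t ^ Suc l) ^ l * f1))"
    unfolding A_lin scaleC_scaleC by (simp add: U_def A_def mult.assoc del: power_Suc)
  also have "\<dots> = (rho (Suc l) * ti ^ Suc l) *\<^sub>C A (u (t ^ Suc l) ^ Suc l) - rho (Suc l) *\<^sub>C A (u (t ^ l) ^ Suc l)"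
    unfolding * A_lin using q0 by (simp add: calg_simps power_inverse del: power_Suc)
  also have "rho (Suc l) *\<^sub>C A (u (t ^ l) ^ Suc l) = V (Suc l)"
    by (simp only: V_def A_def t_cancel ups_simps)
  also have "(rho (Suc l) * ti ^ Suc l) *\<^sub>C A (u (t ^ Suc l) ^ Suc l) = dil ti (R (Suc l))"
    by (simp only: R_def dil_simps dil_u t_cancel A_def scaleC_scaleC ups_simps mult.commute[of "rho (Suc l)"])
  finally show ?thesis by simp
qed

lemma V_0: "V 0 = dil ti (R 0)"
  by (simp add: V_def R_def dil_simps)

text \<open>Telescoping over partial sums; the remainder \<open>U N\<close> starts in degree N + 1,
  so infinite sums are avoided.\<close>

lemma sum_S_f1: "(q - inverse q) *\<^sub>C ups 1 ((\<Sum>l\<le>N. S l) * f1 * ki)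
    = dil ti (\<Sum>l\<le>N. R l) - (\<Sum>l\<le>N. R l) + U N"
proof (induction N)
  case 0
  show ?case using S_f1[of 0] by (simp add: V_0 del: ups_simps)
next
  case (Suc N)
  have "(q - inverse q) *\<^sub>C ups 1 ((\<Sum>l\<le>Suc N. S l) * f1 * ki)
    = (q - inverse q) *\<^sub>C ups 1 ((\<Sum>l\<le>N. S l) * f1 * ki) + (q - inverse q) *\<^sub>C ups 1 (S (Suc N) * f1 * ki)"
    by (simp add: distrib_right ups_linear calg_simps)
  also have "\<dots> = dil ti (\<Sum>l\<le>Suc N. R l) - (\<Sum>l\<le>Suc N. R l) + U (Suc N)"
    unfolding Suc S_f1 by (simp add: dil_linear flip: U_V)
  finally show ?case .
qed

section \<open>The first order equation for E_0 R(z)\<close>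

definition G where
  "G l = (t ^ l * rho l) *\<^sub>C ups l (ki ^ l * (Pd l * (u (t ^ Suc l) ^ l * (dil (t ^ l) E' * Ed l ^ l))))"

text \<open>\<open>G l\<close> has \<open>E'\<close> moved to the right of the u-power;
  \<open>H l\<close> is the \<open>psi\<close>-part of the commutator created when this is done in
  \<open>R (Suc l)\<close>.\<close>

definition H where
  "H l = (t ^ Suc l * theta l) *\<^sub>C ups l (ki ^ l * (Pd l * (u (t ^ Suc l) ^ l * Ed (Suc l) ^ Suc l)))"

lemma e0_R: "(1 - t) *\<^sub>C (e 0 * R l) = (t ^ l * rho l) *\<^sub>C
    ups l (ki ^ l * (Pd l * (dil (t ^ l) E' * (u (t ^ Suc l) ^ l * Ed l ^ l))))"
proof -
  have *: "(1 - t) *\<^sub>C (e 0 * Pd l) = Pd l * dil (t ^ l) E'"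
    using arg_cong[OF e0_P, of "dil (t ^ l)"] by (simp add: dil_simps)
  have "(1 - t) *\<^sub>C (e 0 * R l) = rho l *\<^sub>C ((1 - t) *\<^sub>C ups l ((e 0 * ki ^ l) * (Pd l * (u (t ^ Suc l) ^ l * Ed l ^ l))))"
    by (simp add: R_def mult.assoc mult.commute[of "1 - t"] del: power_Suc)
  also have "\<dots> = (t ^ l * rho l) *\<^sub>C ups l (ki ^ l * (((1 - t) *\<^sub>C (e 0 * Pd l)) * (u (t ^ Suc l) ^ l * Ed l ^ l)))"
    unfolding e0_ki_power by (simp add: mult.assoc mult_ac del: power_Suc)
  finally show ?thesis
    unfolding * by (simp only: mult.assoc)
qed

lemma e0_R_0: "(1 - t) *\<^sub>C (e 0 * R 0) = G 0"
  unfolding e0_R by (simp add: G_def)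

text \<open>\<open>e 0\<close> becomes \<open>E'\<close> behind \<open>P\<close>, and
  \<open>E'\<close> is moved through the u-power. In both parts of the commutator a factor
  \<open>k\<close> cancels one \<open>ki\<close>, which lowers the index from \<open>Suc m\<close>
  to \<open>m\<close>.\<close>

lemma e0_R_Suc: "(1 - t) *\<^sub>C (e 0 * R (Suc m)) = G (Suc m) + H m - t *\<^sub>C dil t (S m)"
proof -
  define l where "l = Suc m"
  define A where "A = (\<lambda>x. ups m (ki ^ l * (Pd l * (x * Ed l ^ l))))"
  have A_lin: "A (x + y) = A x + A y" "A (x - y) = A x - A y" "A (c *\<^sub>C x) = c *\<^sub>C A x" for x y c
    by (simp_all add: A_def algebra_simps ups_linear)
  let ?x = "dil (t ^ l) E'" and ?v = "u (t ^ Suc l)"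
  have "t ^ l *\<^sub>C ups 1 (?x * ?v ^ l) = t ^ l *\<^sub>C ups 1 (?v ^ l * ?x)
     + ((1 - t) * h * geom t (Suc m)) *\<^sub>C (dil (t ^ l) psi * u (t ^ l) ^ m - k * ?v ^ m)"
    using E'_u_power[of "t ^ l" m] unfolding l_def
    by (simp add: ups_linear calg_simps diff_eq_eq mult.commute del: ups_simps power_Suc)
       (simp add: mult.commute)
  hence "rho l *\<^sub>C A (t ^ l *\<^sub>C ups 1 (?x * ?v ^ l)) = rho l *\<^sub>C A (t ^ l *\<^sub>C ups 1 (?v ^ l * ?x))
     + rho l *\<^sub>C A (((1 - t) * h * geom t (Suc m)) *\<^sub>C (dil (t ^ l) psi * u (t ^ l) ^ m - k * ?v ^ m))"
    by (simp only: A_lin calg.scale_right_distrib)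
  also have "rho l *\<^sub>C A (t ^ l *\<^sub>C ups 1 (?x * ?v ^ l)) = (1 - t) *\<^sub>C (e 0 * R l)"
    unfolding e0_R by (simp add: A_def l_def mult.assoc mult_ac del: power_Suc)
  also have "rho l *\<^sub>C A (t ^ l *\<^sub>C ups 1 (?v ^ l * ?x)) = G l"
    unfolding G_def by (simp add: A_def l_def mult.assoc mult_ac del: power_Suc)
  also have "rho l *\<^sub>C A (((1 - t) * h * geom t (Suc m)) *\<^sub>C (dil (t ^ l) psi * u (t ^ l) ^ m - k * ?v ^ m))
     = ((1 - t) * h * geom t (Suc m) * rho (Suc m)) *\<^sub>C (A (dil (t ^ l) psi * u (t ^ l) ^ m) - A (k * ?v ^ m))"
    by (simp only: A_lin l_def scaleC_scaleC mult.commute)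
  also have "(1 - t) * h * geom t (Suc m) * rho (Suc m) = t ^ Suc m * theta m"
    by (rule geom_t)
  also have "A (dil (t ^ l) psi * u (t ^ l) ^ m) = ups m (ki ^ m * (Pd m * (u (t ^ l) ^ m * Ed l ^ l)))"
  proof -
    have "A (dil (t ^ l) psi * u (t ^ l) ^ m) = ups m (ki ^ l * ((Pd l * dil (t ^ l) psi) * (u (t ^ l) ^ m * Ed l ^ l)))"
      by (simp only: A_def mult.assoc)
    also have "\<dots> = ups m (ki ^ m * (Pd m * (u (t ^ l) ^ m * Ed l ^ l)))"
      by (simp only: Pd_psi t_cancel l_def power_Suc2[of ki] mult.assoc ki_k)
    finally show ?thesis .
  qed
  also have "A (k * ?v ^ m) = ups m (ki ^ m * (Pd l * (?v ^ m * Ed l ^ l)))"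
  proof -
    have "A (k * ?v ^ m) = ups m (ki ^ l * ((Pd l * k) * (?v ^ m * Ed l ^ l)))"
      by (simp only: A_def mult.assoc)
    also have "\<dots> = ups m (ki ^ m * (Pd l * (?v ^ m * Ed l ^ l)))"
      by (simp only: Pd_ki l_def power_Suc2[of ki] mult.assoc ki_k)
    finally show ?thesis .
  qed
  also have "G l + (t ^ Suc m * theta m) *\<^sub>C (ups m (ki ^ m * (Pd m * (u (t ^ l) ^ m * Ed l ^ l)))
      - ups m (ki ^ m * (Pd l * (?v ^ m * Ed l ^ l)))) = G l + H m - t *\<^sub>C dil t (S m)"
  proof -
    have "t *\<^sub>C dil t (S m) = (t ^ Suc m * theta m) *\<^sub>C ups m (ki ^ m * (Pd l * (?v ^ m * Ed l ^ l)))"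
      by (simp add: S_def dil_simps dil_u l_def mult_ac)
    thus ?thesis by (simp add: H_def l_def calg.scale_right_diff_distrib del: power_Suc)
  qed
  finally show ?thesis unfolding l_def .
qed

text \<open>The power of \<open>Ed (Suc m)\<close> is expanded in powers of \<open>Ed m\<close> by
  \<open>power_expand\<close>; the mixed terms cancel against those of \<open>E'\<close>.\<close>

lemma G_H: "G m + H m = S m"
proof -
  let ?a = "Ed (Suc m)" and ?b = "Ed m"
  have quad: "?a * ?a = (1 + ti) *\<^sub>C (?a * ?b) - ti *\<^sub>C (?b * ?b)"
    using arg_cong[OF E_quadratic, of "dil (t ^ Suc m)"] by (simp only: dil_simps t_cancel)
  have E': "dil (t ^ m) E' = ?b - t *\<^sub>C ?a"
    by (simp add: E'_def dil_simps mult.commute)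
  have c1: "t ^ m * rho m - t ^ Suc m * theta m * (ti * geom ti m) = theta m"
  proof -
    have "t ^ Suc m * theta m * (ti * geom ti m) = (t ^ Suc m * ti) * (theta m * geom ti m)"
      by (simp only: mult_ac)
    hence "t ^ m * rho m - t ^ Suc m * theta m * (ti * geom ti m)
        = t ^ m * (theta m * geom ti (Suc m) - theta m * geom ti m)"
      by (simp only: t_cancel theta_geom right_diff_distrib)
    also have "\<dots> = (t ^ m * ti ^ m) * theta m"
      by (simp only: geom_Suc right_diff_distrib[symmetric]) (simp only: add_diff_cancel_left' mult_ac)
    finally show ?thesis
      by (simp only: t_ti_pow mult_1_left)
  qed
  have c2: "t ^ Suc m * theta m * geom ti (Suc m) - t ^ m * rho m * t = 0"
    by (simp add: theta_geom[symmetric])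
  have "(t ^ m * rho m) *\<^sub>C (dil (t ^ m) E' * ?b ^ m) + (t ^ Suc m * theta m) *\<^sub>C ?a ^ Suc m
      = (t ^ m * rho m - t ^ Suc m * theta m * (ti * geom ti m)) *\<^sub>C ?b ^ Suc m
        + (t ^ Suc m * theta m * geom ti (Suc m) - t ^ m * rho m * t) *\<^sub>C (?a * ?b ^ m)"
    unfolding power_expand[OF quad] E'
    by (simp only: left_diff_distrib calg.scale_right_diff_distrib calg.scale_left_diff_distrib
        scaleC_scaleC calg_mult_simps power_Suc mult.assoc) (simp add: algebra_simps)
  also have "\<dots> = theta m *\<^sub>C ?b ^ Suc m"
    unfolding c1 c2 by simp
  finally have *: "(t ^ m * rho m) *\<^sub>C (dil (t ^ m) E' * ?b ^ m) + (t ^ Suc m * theta m) *\<^sub>C ?a ^ Suc m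
      = theta m *\<^sub>C ?b ^ Suc m" .
  have "G m + H m = ups m (ki ^ m * (Pd m * (u (t ^ Suc m) ^ m *
    ((t ^ m * rho m) *\<^sub>C (dil (t ^ m) E' * ?b ^ m) + (t ^ Suc m * theta m) *\<^sub>C ?a ^ Suc m))))"
    by (simp add: G_def H_def distrib_left ups_linear del: power_Suc)
  thus ?thesis unfolding * by (simp add: S_def del: power_Suc)
qed

text \<open>Each step merges the remainder \<open>G N\<close> with the new \<open>H N\<close> into
  \<open>S N\<close>; the remainder starts in degree N.\<close>

lemma sum_e0_R: "(1 - t) *\<^sub>C (e 0 * (\<Sum>l\<le>N. R l)) = G N + (\<Sum>l<N. S l - t *\<^sub>C dil t (S l))"
proof (induction N)
  case 0
  show ?case by (simp add: e0_R_0)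
next
  case (Suc N)
  have "(1 - t) *\<^sub>C (e 0 * (\<Sum>l\<le>Suc N. R l)) = (1 - t) *\<^sub>C (e 0 * (\<Sum>l\<le>N. R l)) + (1 - t) *\<^sub>C (e 0 * R (Suc N))"
    by (simp add: distrib_left calg.scale_right_distrib)
  thus ?case
    unfolding Suc e0_R_Suc by (simp add: G_H[symmetric])
qed

section \<open>Comparison of coefficients\<close>

lemma sum_nth_stable:
  fixes f :: "nat \<Rightarrow> 'a fps"
  assumes "\<And>l. l > n \<Longrightarrow> f l $ n = 0" "n \<le> N"
  shows "(\<Sum>l\<le>N. f l) $ n = (\<Sum>l\<le>n. f l $ n)"
  unfolding fps_sum_nth using assms by (intro sum.mono_neutral_right) auto

lemma R_nth: "n < l \<Longrightarrow> R l $ n = 0" and S_nth: "n < l \<Longrightarrow> S l $ n = 0"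
  by (simp_all add: R_def S_def ups_nth)

text \<open>Eliminating \<open>s\<close> between the two first order equations gives a recursion
  from \<open>r n\<close> to \<open>r (Suc n)\<close>; by \<open>rho_rec\<close> the left-hand side
  obeys the same one, whose leading factor is nonzero.\<close>

theorem divided_power_identity:
  "rho n *\<^sub>C ((E $ 0) ^ n * F1 ^ n * Ki ^ n) = (\<Sum>l\<le>n. R l $ n)"
proof (induction n)
  case 0
  show ?case by (simp add: R_def ups_nth P_0 rho_def qfact_def fps_power_zeroth)
next
  case (Suc n)
  define r where "r n = (\<Sum>l\<le>n. R l $ n)" for n
  define s where "s = (\<Sum>l\<le>n. S l $ n)"
  \<comment> \<open>With cutoff \<open>Suc n\<close> the remainder \<open>G (Suc n)\<close> is
    invisible in coefficient n.\<close>
  have "(1 - t) *\<^sub>C (E $ 0 * (\<Sum>l\<le>Suc n. R l) $ n) = (\<Sum>l<Suc n. S l - t *\<^sub>C dil t (S l)) $ n"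
    using arg_cong[OF sum_e0_R[of "Suc n"], of "\<lambda>f. f $ n"] by (simp add: G_def ups_nth)
  also have "(\<Sum>l\<le>Suc n. R l) $ n = r n"
    unfolding r_def by (rule sum_nth_stable) (simp_all add: R_nth)
  also have "(\<Sum>l<Suc n. S l - t *\<^sub>C dil t (S l)) $ n = (1 - t ^ Suc n) *\<^sub>C s"
    unfolding s_def lessThan_Suc_atMost fps_sum_nth
    by (simp add: sum_subtractf calg.scale_left_diff_distrib calg.scale_sum_right)
  finally have 1: "(1 - t) *\<^sub>C (E $ 0 * r n) = (1 - t ^ Suc n) *\<^sub>C s" .
  \<comment> \<open>The factor z^-1 links coefficient n of S to coefficient n + 1 of R;
    \<open>U (Suc n)\<close> starts only in degree n + 2.\<close>
  have "(q - inverse q) *\<^sub>C ((\<Sum>l\<le>Suc n. S l) $ n * F1 * Ki)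
      = (ti ^ Suc n - 1) *\<^sub>C (\<Sum>l\<le>Suc n. R l) $ Suc n"
    using arg_cong[OF sum_S_f1[of "Suc n"], of "\<lambda>f. f $ Suc n"]
    by (simp add: U_def ups_nth calg.scale_left_diff_distrib)
  also have "(\<Sum>l\<le>Suc n. S l) $ n = s"
    unfolding s_def by (rule sum_nth_stable) (simp_all add: S_nth)
  also have "(\<Sum>l\<le>Suc n. R l) $ Suc n = r (Suc n)"
    unfolding r_def by (rule sum_nth_stable) (simp_all add: R_nth)
  finally have 2: "(q - inverse q) *\<^sub>C (s * F1 * Ki) = (ti ^ Suc n - 1) *\<^sub>C r (Suc n)" .
  have Ki_F: "Ki ^ n * F1 = t ^ n *\<^sub>C (F1 * Ki ^ n)"
    by (rule commute_power) (use inverse_commute[OF F_K(1)] q0 in simp)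
  have rn: "r n = rho n *\<^sub>C ((E $ 0) ^ n * F1 ^ n * Ki ^ n)"
    by (simp only: r_def Suc)
  have "((1 - t ^ Suc n) * (ti ^ Suc n - 1)) *\<^sub>C r (Suc n)
      = (q - inverse q) *\<^sub>C (((1 - t ^ Suc n) *\<^sub>C s) * F1 * Ki)"
    unfolding scaleC_scaleC[symmetric] 2[symmetric] by (simp add: mult_ac)
  also have "\<dots> = ((q - inverse q) * (1 - t) * rho n) *\<^sub>C (E $ 0 * ((E $ 0) ^ n * (F1 ^ n * ((Ki ^ n * F1) * Ki))))"
    unfolding 1[symmetric] by (simp add: rn mult.assoc)
  also have "\<dots> = ((q - inverse q) * (1 - t) * t ^ n * rho n) *\<^sub>C (E $ 0 * ((E $ 0) ^ n * (F1 ^ n * (F1 * (Ki ^ n * Ki)))))"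
    unfolding Ki_F by (simp add: mult.assoc mult.commute[of "rho n"])
  also have "E $ 0 * ((E $ 0) ^ n * (F1 ^ n * (F1 * (Ki ^ n * Ki)))) = (E $ 0) ^ Suc n * F1 ^ Suc n * Ki ^ Suc n"
    by (simp only: power_Suc[of "E $ 0"] power_Suc2[of F1] power_Suc2[of Ki] mult.assoc)
  also have "((q - inverse q) * (1 - t) * t ^ n * rho n) *\<^sub>C ((E $ 0) ^ Suc n * F1 ^ Suc n * Ki ^ Suc n)
      = ((1 - t ^ Suc n) * (ti ^ Suc n - 1)) *\<^sub>C (rho (Suc n) *\<^sub>C ((E $ 0) ^ Suc n * F1 ^ Suc n * Ki ^ Suc n))"
    by (simp only: rho_rec scaleC_scaleC)
  finally have eq: "((1 - t ^ Suc n) * (ti ^ Suc n - 1)) *\<^sub>C r (Suc n)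
      = ((1 - t ^ Suc n) * (ti ^ Suc n - 1)) *\<^sub>C (rho (Suc n) *\<^sub>C ((E $ 0) ^ Suc n * F1 ^ Suc n * Ki ^ Suc n))" .
  have "(1 - t ^ Suc n) * (ti ^ Suc n - 1) \<noteq> 0"
    using t_pow[of "Suc n"] ti_pow[of "Suc n"] by (simp del: power_Suc)
  from calg.scale_left_imp_eq[OF this eq]
  have "r (Suc n) = rho (Suc n) *\<^sub>C ((E $ 0) ^ Suc n * F1 ^ Suc n * Ki ^ Suc n)" .
  thus ?case by (simp only: r_def)
qed

end

section \<open>Scalars and classes in presented algebras\<close>

lemma scalar_central: "x * scalar c = scalar c * x" for x :: "'g free_alg"
proof (induction x rule: update_induct)
  case (update f a b)
  have "Poly_Mapping.update a b f = f + Poly_Mapping.single a b"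
    using update(1) by (intro poly_mapping_eqI)
      (auto simp: lookup_add lookup_single lookup_update when_def in_keys_iff)
  thus ?case
    using update(3) by (simp add: algebra_simps scalar_def mult_single)
qed simp

lemma pres_cls_surj: "X \<in> carrier (pres_alg R) \<Longrightarrow> \<exists>x. X = pres_cls R x"
  by (auto simp: pres_alg_simps FactRing_def A_RCOSETS_def' pres_cls_def)

lemma pres_cls_uminus: "pres_cls R (- x) = \<ominus>\<^bsub>pres_alg R\<^esub> pres_cls R x"
proof -
  interpret A: ring "pres_alg R" by (rule ring_pres_alg)
  have "pres_cls R (- x) \<oplus>\<^bsub>pres_alg R\<^esub> pres_cls R x = \<zero>\<^bsub>pres_alg R\<^esub>"
    by (simp add: pres_cls_zero flip: pres_cls_hom(3))
  thus ?thesis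
    by (metis A.minus_equality pres_cls_hom(1))
qed

lemma pres_cls_smult: "c \<odot>\<^bsub>pres_alg R\<^esub> pres_cls R x = pres_cls R (scalar c * x)"
  by (simp add: pres_alg_simps pres_cls_hom)

section \<open>Transfer to the quantum loop algebra\<close>

text \<open>
  A type cannot depend on \<open>q\<close>, so the type class reasoning takes place in the product of all the
  algebras \<open>Uq p\<close>.  The extra factor \<open>\<complex>\<close> provides \<open>0 \<noteq> 1\<close>.
\<close>

typedef Uq_prod = "{x :: complex \<times> (complex \<Rightarrow> Uq_gen free_alg set). \<forall>p. snd x p \<in> carrier (Uq p)}"
proof
  show "(0, \<lambda>p. \<zero>\<^bsub>Uq p\<^esub>) \<in> {x. \<forall>p. snd x p \<in> carrier (Uq p)}"
    using ring.ring_simprules(2)[OF ring_Uq] by simp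
qed

setup_lifting type_definition_Uq_prod

lemma Uq_simps:
  fixes p :: complex
  shows "x \<in> carrier (Uq p) \<Longrightarrow> \<exists>y. x = pres_cls (Uq_relations p) y"
    and "pres_cls (Uq_relations p) y \<in> carrier (Uq p)"
    and "\<zero>\<^bsub>Uq p\<^esub> = pres_cls (Uq_relations p) 0"
    and "\<one>\<^bsub>Uq p\<^esub> = pres_cls (Uq_relations p) 1"
    and "pres_cls (Uq_relations p) y \<oplus>\<^bsub>Uq p\<^esub> pres_cls (Uq_relations p) z = pres_cls (Uq_relations p) (y + z)"
    and "pres_cls (Uq_relations p) y \<otimes>\<^bsub>Uq p\<^esub> pres_cls (Uq_relations p) z = pres_cls (Uq_relations p) (y * z)"
    and "\<ominus>\<^bsub>Uq p\<^esub> pres_cls (Uq_relations p) y = pres_cls (Uq_relations p) (- y)"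
    and "c \<odot>\<^bsub>Uq p\<^esub> pres_cls (Uq_relations p) y = pres_cls (Uq_relations p) (scalar c * y)"
  by (simp_all add: Uq_def pres_cls_surj pres_cls_hom pres_cls_zero pres_cls_uminus pres_cls_smult)

lemma Uq_cases:
  assumes "x \<in> carrier (Uq p)"
  obtains y where "x = pres_cls (Uq_relations p) y"
  using assms Uq_simps(1) by blast

instantiation Uq_prod :: calg
begin

lift_definition zero_Uq_prod :: Uq_prod is "(0, \<lambda>p. \<zero>\<^bsub>Uq p\<^esub>)"
  by (simp add: Uq_simps)
lift_definition one_Uq_prod :: Uq_prod is "(1, \<lambda>p. \<one>\<^bsub>Uq p\<^esub>)"
  by (simp add: Uq_simps)
lift_definition plus_Uq_prod :: "Uq_prod \<Rightarrow> Uq_prod \<Rightarrow> Uq_prod"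
  is "\<lambda>x y. (fst x + fst y, \<lambda>p. snd x p \<oplus>\<^bsub>Uq p\<^esub> snd y p)"
  by (simp add: ring.ring_simprules[OF ring_Uq])
lift_definition times_Uq_prod :: "Uq_prod \<Rightarrow> Uq_prod \<Rightarrow> Uq_prod"
  is "\<lambda>x y. (fst x * fst y, \<lambda>p. snd x p \<otimes>\<^bsub>Uq p\<^esub> snd y p)"
  by (simp add: ring.ring_simprules[OF ring_Uq])
lift_definition uminus_Uq_prod :: "Uq_prod \<Rightarrow> Uq_prod"
  is "\<lambda>x. (- fst x, \<lambda>p. \<ominus>\<^bsub>Uq p\<^esub> snd x p)"
  by (simp add: ring.ring_simprules[OF ring_Uq])
lift_definition minus_Uq_prod :: "Uq_prod \<Rightarrow> Uq_prod \<Rightarrow> Uq_prod"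
  is "\<lambda>x y. (fst x - fst y, \<lambda>p. snd x p \<ominus>\<^bsub>Uq p\<^esub> snd y p)"
  by (simp add: ring.ring_simprules[OF ring_Uq])
lift_definition scaleC_Uq_prod :: "complex \<Rightarrow> Uq_prod \<Rightarrow> Uq_prod"
  is "\<lambda>c x. (c * fst x, \<lambda>p. c \<odot>\<^bsub>Uq p\<^esub> snd x p)"
  by (auto simp: smult_Uq scalar_carrier ring.ring_simprules[OF ring_Uq])

instance
proof
  fix a b c :: Uq_prod and r s :: complex
  note R = ring.ring_simprules[OF ring_Uq]
  show "a + b + c = a + (b + c)" by transfer (auto simp: R fun_eq_iff)
  show "a + b = b + a" by transfer (auto intro!: ext R(10))
  show "0 + a = a" by transfer (auto simp: R fun_eq_iff)
  show "- a + a = 0" by transfer (auto simp: R fun_eq_iff)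
  show "a - b = a + - b" by transfer (auto simp: a_minus_def)
  show "a * b * c = a * (b * c)" by transfer (auto simp: R fun_eq_iff)
  show "1 * a = a" by transfer (auto simp: R)
  show "a * 1 = a" by transfer (auto simp: monoid.r_one[OF ring.is_monoid[OF ring_Uq]])
  show "(a + b) * c = a * c + b * c" by transfer (auto simp: R fun_eq_iff algebra_simps)
  show "a * (b + c) = a * b + a * c" by transfer (auto simp: R fun_eq_iff algebra_simps)
  show "(0::Uq_prod) \<noteq> 1" by transfer simp
  show "r *\<^sub>C (a + b) = r *\<^sub>C a + r *\<^sub>C b"
    by transfer (auto simp: fun_eq_iff smult_Uq scalar_carrier R algebra_simps)
  \<comment> \<open>Scalars act by left multiplication, so pulling them out of a right factor
    requires their centrality.\<close>
  have scalar_comm: "x \<otimes>\<^bsub>Uq p\<^esub> pres_cls (Uq_relations p) (scalar r) = pres_cls (Uq_relations p) (scalar r) \<otimes>\<^bsub>Uq p\<^esub> x"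
    if "x \<in> carrier (Uq p)" for x p r
    using that by (elim Uq_cases) (simp add: Uq_simps scalar_central)
  show "(r + s) *\<^sub>C a = r *\<^sub>C a + s *\<^sub>C a"
    by transfer (auto simp: fun_eq_iff smult_Uq scalar_carrier scalar_simps algebra_simps R simp flip: Uq_simps(5))
  show "r *\<^sub>C s *\<^sub>C a = (r * s) *\<^sub>C a"
    by transfer (auto simp: fun_eq_iff smult_Uq scalar_carrier scalar_simps R simp flip: Uq_simps(6))
  show "1 *\<^sub>C a = a"
    by transfer (auto simp: fun_eq_iff smult_Uq scalar_simps R simp flip: Uq_simps(4))
  show "r *\<^sub>C a * b = r *\<^sub>C (a * b)"
    by transfer (auto simp: fun_eq_iff smult_Uq scalar_carrier R)
  have "x \<otimes>\<^bsub>Uq p\<^esub> (pres_cls (Uq_relations p) (scalar r) \<otimes>\<^bsub>Uq p\<^esub> y)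
      = pres_cls (Uq_relations p) (scalar r) \<otimes>\<^bsub>Uq p\<^esub> (x \<otimes>\<^bsub>Uq p\<^esub> y)"
    if "x \<in> carrier (Uq p)" "y \<in> carrier (Uq p)" for x y p
    using that scalar_comm[of x p r] R(11)[OF scalar_carrier[of p r] that]
      R(11)[OF that(1) scalar_carrier[of p r] that(2)] by simp
  thus "a * r *\<^sub>C b = r *\<^sub>C (a * b)"
    by transfer (auto simp: fun_eq_iff smult_Uq)
qed

end

definition proj :: "complex \<Rightarrow> Uq_prod \<Rightarrow> Uq_gen free_alg set" where
  "proj p x = snd (Rep_Uq_prod x) p"

lemma proj_carrier [simp]: "proj p x \<in> carrier (Uq p)"
  using Rep_Uq_prod[of x] by (simp add: proj_def)

lemma proj_hom:
  "proj p 0 = \<zero>\<^bsub>Uq p\<^esub>" "proj p 1 = \<one>\<^bsub>Uq p\<^esub>"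
  "proj p (x + y) = proj p x \<oplus>\<^bsub>Uq p\<^esub> proj p y"
  "proj p (x - y) = proj p x \<ominus>\<^bsub>Uq p\<^esub> proj p y"
  "proj p (x * y) = proj p x \<otimes>\<^bsub>Uq p\<^esub> proj p y"
  "proj p (c *\<^sub>C x) = c \<odot>\<^bsub>Uq p\<^esub> proj p x"
  by (simp_all add: proj_def zero_Uq_prod.rep_eq one_Uq_prod.rep_eq plus_Uq_prod.rep_eq
      minus_Uq_prod.rep_eq times_Uq_prod.rep_eq scaleC_Uq_prod.rep_eq)

lemma proj_sum: "finite A \<Longrightarrow> proj p (\<Sum>i\<in>A. f i) = (\<Oplus>\<^bsub>Uq p\<^esub>i\<in>A. proj p (f i))"
proof (induction A rule: finite_induct)
  case empty
  interpret ring "Uq p" by (rule ring_Uq)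
  show ?case by (simp add: proj_hom)
next
  case (insert i A)
  interpret ring "Uq p" by (rule ring_Uq)
  show ?case using insert by (simp add: proj_hom finsum_insert)
qed

lemma proj_power: "proj p (x ^ n) = proj p x [^]\<^bsub>Uq p\<^esub> n"
proof -
  interpret ring "Uq p" by (rule ring_Uq)
  show ?thesis
    by (induction n) (simp_all add: proj_hom power_Suc2 del: power_Suc)
qed

text \<open>
  At \<open>q\<close> an element of the free algebra is mapped to its class; everywhere else it is replaced by a
  scalar.  With the scalars \<open>0\<close> for \<open>E\<^sub>k\<close>, \<open>F\<^sub>k\<close>, \<open>\<psi>\<^sup>\<plusminus>\<^sub>r\<close> (\<open>r \<noteq> 0\<close>) and \<open>1\<close> for \<open>K\<^sup>\<plusminus>\<^sup>1\<close>, the relations with parameter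
  \<open>q\<close> hold in all factors.
\<close>

lift_definition cl :: "complex \<Rightarrow> complex \<Rightarrow> Uq_gen free_alg \<Rightarrow> Uq_prod" is
  "\<lambda>q c x. (c, \<lambda>p. pres_cls (Uq_relations p) (if p = q then x else scalar c))"
  by (simp add: Uq_simps)

lemma proj_cl: "proj q (cl q c x) = pres_cls (Uq_relations q) x"
  by (simp add: proj_def cl.rep_eq)

lemma cl_hom:
  "cl q c x + cl q d y = cl q (c + d) (x + y)"
  "cl q c x - cl q d y = cl q (c - d) (x - y)"
  "cl q c x * cl q d y = cl q (c * d) (x * y)"
  "b *\<^sub>C cl q c x = cl q (b * c) (scalar b * x)"
  "cl q 0 0 = 0" "cl q 1 1 = 1"
proof -
  have [simp]: "scalar (c - d) = scalar c - scalar d"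
    by (simp add: scalar_def single_diff)
  show "cl q c x + cl q d y = cl q (c + d) (x + y)"
    "cl q c x - cl q d y = cl q (c - d) (x - y)"
    "cl q c x * cl q d y = cl q (c * d) (x * y)"
    "b *\<^sub>C cl q c x = cl q (b * c) (scalar b * x)"
    "cl q 0 0 = 0" "cl q 1 1 = 1"
    by (rule Rep_Uq_prod_inject[THEN iffD1],
        simp add: cl.rep_eq zero_Uq_prod.rep_eq one_Uq_prod.rep_eq plus_Uq_prod.rep_eq
          minus_Uq_prod.rep_eq times_Uq_prod.rep_eq scaleC_Uq_prod.rep_eq Uq_simps scalar_simps
          a_minus_def fun_eq_iff)+
qed

lemma cl_eqI:
  assumes "c = d" "pres_cls (Uq_relations q) x = pres_cls (Uq_relations q) y"
  shows "cl q c x = cl q d y"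
  using assms by (intro Rep_Uq_prod_inject[THEN iffD1]) (simp add: cl.rep_eq fun_eq_iff)

lemma cl_relI: "x - y \<in> Uq_relations q \<Longrightarrow> c = d \<Longrightarrow> cl q c x = cl q d y"
  by (intro cl_eqI pres_cls_rel)

lemma cl_sum: "finite A \<Longrightarrow> (\<Sum>i\<in>A. cl q (c i) (x i)) = cl q (\<Sum>i\<in>A. c i) (\<Sum>i\<in>A. x i)"
  by (induction A rule: finite_induct) (simp_all add: cl_hom)

section \<open>From power series over the product to series over \<open>Uq\<close>\<close>

definition pser :: "complex \<Rightarrow> Uq_prod fps \<Rightarrow> nat \<Rightarrow> Uq_gen free_alg set" where
  "pser p f = (\<lambda>n. proj p (f $ n))"

lemma pser_mult: "pser p f \<otimes>\<^bsub>Uq_series p\<^esub> pser p g = pser p (f * g)"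
  by (simp add: pser_def series_alg_def fps_mult_nth proj_sum proj_hom atLeast0AtMost)

lemma pser_one: "\<one>\<^bsub>Uq_series p\<^esub> = pser p 1"
  by (auto simp: pser_def series_alg_def proj_hom fun_eq_iff)

lemma pser_scaleC: "c \<odot>\<^bsub>Uq_series p\<^esub> pser p f = pser p (c *\<^sub>C f)"
  by (simp add: pser_def series_alg_def proj_hom)

lemma pser_power: "pser p f [^]\<^bsub>Uq_series p\<^esub> (n::nat) = pser p (f ^ n)"
  by (induction n) (simp_all add: nat_pow_def pser_one pser_mult power_Suc2 del: power_Suc)

lemma divpow_proj: "divpow q (Uq p) (proj p x) n = proj p ((1 / qfact q n) *\<^sub>C x ^ n)"
  by (simp add: divpow_def proj_hom proj_power)

lemma divpow_pser: "divpow q (Uq_series p) (pser p f) n = pser p ((1 / qfact q n) *\<^sub>C f ^ n)"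
  by (simp add: divpow_def pser_power pser_scaleC)

lemma zmonom_proj: "zmonom (Uq p) (proj p x) m = pser p (ups m (fps_const x))"
  by (auto simp: zmonom_def pser_def ups_nth proj_hom fun_eq_iff)

lemma zscale_pser: "c \<noteq> 0 \<Longrightarrow> zscale (Uq p) c (pser p f) = pser p (dil (inverse c) f)"
  by (simp add: zscale_def pser_def proj_hom power_int_minus power_inverse)

text \<open>Negation in \<open>series_alg\<close> is the inverse in its additive group, so it is
  identified through uniqueness of inverses.\<close>

lemma pser_minus: "pser p f \<ominus>\<^bsub>Uq_series p\<^esub> pser p g = pser p (f - g)"
proof -
  interpret U: ring "Uq p" by (rule ring_Uq)
  have grp: "abelian_group (Uq_series p)"
  proof (rule abelian_groupI)
    fix f assume "f \<in> carrier (Uq_series p)"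
    thus "\<exists>g\<in>carrier (Uq_series p). g \<oplus>\<^bsub>Uq_series p\<^esub> f = \<zero>\<^bsub>Uq_series p\<^esub>"
      by (intro bexI[of _ "\<lambda>n. \<ominus>\<^bsub>Uq p\<^esub> f n"]) (simp_all add: series_alg_def U.l_neg)
  qed (auto simp: series_alg_def U.a_assoc intro!: ext U.a_comm)
  have "(\<ominus>\<^bsub>Uq_series p\<^esub> pser p g) = pser p (- g)"
  proof (rule abelian_group.minus_equality[OF grp])
    have "proj p (- x) \<oplus>\<^bsub>Uq p\<^esub> proj p x = \<zero>\<^bsub>Uq p\<^esub>" for x
      by (simp flip: proj_hom)
    thus "pser p (- g) \<oplus>\<^bsub>Uq_series p\<^esub> pser p g = \<zero>\<^bsub>Uq_series p\<^esub>"
      by (simp add: series_alg_def pser_def)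
  qed (simp_all add: series_alg_def pser_def)
  hence "pser p f \<ominus>\<^bsub>Uq_series p\<^esub> pser p g = pser p f \<oplus>\<^bsub>Uq_series p\<^esub> pser p (- g)"
    by (simp add: a_minus_def)
  also have "\<dots> = pser p (f - g)"
    by (simp add: series_alg_def pser_def flip: proj_hom)
  finally show ?thesis .
qed

lemma series_sum_eq:
  assumes A: "ring A" and closed: "\<And>l. f l n \<in> carrier A" and zero: "\<And>l. n < l \<Longrightarrow> f l n = \<zero>\<^bsub>A\<^esub>"
  shows "series_sum A f n = (\<Oplus>\<^bsub>A\<^esub>l\<in>{..n}. f l n)"
proof -
  interpret ring A by (rule A)
  have "{l. f l n \<noteq> \<zero>\<^bsub>A\<^esub>} \<subseteq> {..n}"
    using zero by (metis (mono_tags, lifting) atMost_iff leI mem_Collect_eq subsetI)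
  thus ?thesis
    unfolding series_sum_def using closed by (intro add.finprod_mono_neutral_cong_left) auto
qed

lemma series_sum_pser:
  assumes "\<And>l n. n < l \<Longrightarrow> f l $ n = 0"
  shows "series_sum (Uq p) (\<lambda>l. pser p (f l)) n = proj p (\<Sum>l\<le>n. f l $ n)"
proof -
  have "series_sum (Uq p) (\<lambda>l. pser p (f l)) n = (\<Oplus>\<^bsub>Uq p\<^esub>l\<in>{..n}. pser p (f l) n)"
    by (rule series_sum_eq) (simp_all add: ring_Uq pser_def assms proj_hom)
  thus ?thesis by (simp add: pser_def proj_sum)
qed

text \<open>Induction over the generated ring; applied to the coefficients of \<open>P_plus\<close>,
  which lie in this subalgebra by definition.\<close>

lemma psi_subalg_commute:
  assumes "x \<in> psi_subalg q"
  shows "x \<otimes>\<^bsub>Uq q\<^esub> Uq_psi_plus q m = Uq_psi_plus q m \<otimes>\<^bsub>Uq q\<^esub> x" "x \<in> carrier (Uq q)"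
proof -
  interpret U: ring "Uq q" by (rule ring_Uq)
  let ?c = "pres_cls (Uq_relations q)"
  have psi: "a * fpsi_plus m - fpsi_plus m * a \<in> Uq_relations q" if "a \<in> range fpsi_plus \<union> range fpsi_minus" for a
    using that unfolding Uq_relations_def by (intro UnI1 CollectI) blast
  have gens: "?c a \<otimes>\<^bsub>Uq q\<^esub> Uq_psi_plus q m = Uq_psi_plus q m \<otimes>\<^bsub>Uq q\<^esub> ?c a"
    if "a \<in> range fpsi_plus \<union> range fpsi_minus" for a
    unfolding Uq_psi_plus_def Uq_simps by (rule pres_cls_rel[OF psi[OF that]])
  have cl: "Uq_psi_plus q m \<in> carrier (Uq q)"
    by (simp add: Uq_psi_plus_def Uq_simps)
  have "x \<in> carrier (Uq q) \<and> x \<otimes>\<^bsub>Uq q\<^esub> Uq_psi_plus q m = Uq_psi_plus q m \<otimes>\<^bsub>Uq q\<^esub> x"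
    using assms unfolding psi_subalg_def
  proof (induction rule: generate_ring.induct)
    case one
    show ?case using cl by simp
  next
    case (incl h)
    then consider c where "h = c \<odot>\<^bsub>Uq q\<^esub> \<one>\<^bsub>Uq q\<^esub>" | a where "a \<in> range fpsi_plus \<union> range fpsi_minus" "h = ?c a"
      by (auto simp: Uq_psi_plus_def Uq_psi_minus_def)
    thus ?case
    proof cases
      case 1
      thus ?thesis by (simp add: Uq_psi_plus_def Uq_simps scalar_central)
    next
      case 2
      thus ?thesis using gens by (simp add: Uq_simps)
    qed
  next
    case (a_inv h)
    thus ?case using cl by (simp add: U.l_minus U.r_minus)
  next
    case (eng_add h1 h2)
    thus ?case using cl by (simp add: U.l_distr U.r_distr)
  next
    case (eng_mult h1 h2)
    thus ?case using cl by (metis U.m_assoc U.m_closed)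
  qed
  thus "x \<otimes>\<^bsub>Uq q\<^esub> Uq_psi_plus q m = Uq_psi_plus q m \<otimes>\<^bsub>Uq q\<^esub> x" "x \<in> carrier (Uq q)"
    by blast+
qed

lemma Uq_rel:
  fixes q :: complex and k l :: int
  defines "R \<equiv> Uq_relations q"
  shows "fpsi_plus 0 * fpsi_minus 0 - 1 \<in> R"
    and "fpsi_plus k * fpsi_plus l - fpsi_plus l * fpsi_plus k \<in> R"
    and "fpsi_plus k * fpsi_minus l - fpsi_minus l * fpsi_plus k \<in> R"
    and "fpsi_plus 0 * fE k * fpsi_minus 0 - scalar (q powi 2) * fE k \<in> R"
    and "fpsi_plus 0 * fF k * fpsi_minus 0 - scalar (q powi (-2)) * fF k \<in> R"
    and "k \<ge> 0 \<Longrightarrow> (fpsi_plus (k + 1) * fE l - scalar (q powi 2) * (fE l * fpsi_plus (k + 1)))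
       - (scalar (q powi 2) * (fpsi_plus k * fE (l + 1)) - fE (l + 1) * fpsi_plus k) \<in> R"
    and "k \<ge> 0 \<Longrightarrow> (fpsi_plus (k + 1) * fF l - scalar (q powi (-2)) * (fF l * fpsi_plus (k + 1)))
       - (scalar (q powi (-2)) * (fpsi_plus k * fF (l + 1)) - fF (l + 1) * fpsi_plus k) \<in> R"
    and "(fE (k + 1) * fE l - scalar (q powi 2) * (fE l * fE (k + 1)))
       - (scalar (q powi 2) * (fE k * fE (l + 1)) - fE (l + 1) * fE k) \<in> R"
    and "(fF (k + 1) * fF l - scalar (q powi (-2)) * (fF l * fF (k + 1)))
       - (scalar (q powi (-2)) * (fF k * fF (l + 1)) - fF (l + 1) * fF k) \<in> R"
    and "(fE k * fF l - fF l * fE k)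
       - scalar (1 / (q - inverse q)) * (fpsi_plus (k + l) - fpsi_minus (k + l)) \<in> R"
  unfolding R_def Uq_relations_def
  \<comment> \<open>The unions nest to the left, so the number of \<open>UnI1\<close> counts the
    family's distance from the last one.\<close>
  subgoal by (rule UnI2[THEN UnI1, THEN UnI1, THEN UnI1, THEN UnI1, THEN UnI1, THEN UnI1, THEN UnI1, THEN UnI1, THEN UnI1], blast)
  subgoal by (intro UnI1, blast)
  subgoal by (intro UnI1, blast)
  subgoal by (rule UnI2[THEN UnI1, THEN UnI1, THEN UnI1, THEN UnI1, THEN UnI1, THEN UnI1, THEN UnI1, THEN UnI1], blast)
  subgoal by (rule UnI2[THEN UnI1, THEN UnI1, THEN UnI1, THEN UnI1, THEN UnI1, THEN UnI1], blast)
  subgoal by (rule UnI2[THEN UnI1, THEN UnI1, THEN UnI1, THEN UnI1], blast)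
  subgoal by (rule UnI2[THEN UnI1, THEN UnI1, THEN UnI1], blast)
  subgoal by (rule UnI2[THEN UnI1, THEN UnI1], blast)
  subgoal by (rule UnI2[THEN UnI1], blast)
  subgoal by (rule UnI2, blast)
  done

section \<open>The quantum loop algebra as an instance of the locale\<close>

definition E_ser :: "complex \<Rightarrow> Uq_prod fps" where
  "E_ser q = Abs_fps (\<lambda>n. cl q 0 (fE (int n)))"

definition psi_ser :: "complex \<Rightarrow> Uq_prod fps" where
  "psi_ser q = Abs_fps (\<lambda>n. cl q (if n = 0 then 1 else 0) (fpsi_plus (int n)))"

text \<open>\<open>cl\<close> expects an element of the free algebra, hence the choice of
  representatives.\<close>

definition P_rep :: "complex \<Rightarrow> nat \<Rightarrow> Uq_gen free_alg" where
  "P_rep q n = (SOME x. P_plus q n = pres_cls (Uq_relations q) x)"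

text \<open>Away from \<open>q\<close> this is the series 1, and so is \<open>psi_ser\<close>; the
  functional equation therefore holds there too.\<close>

definition P_ser :: "complex \<Rightarrow> Uq_prod fps" where
  "P_ser q = Abs_fps (\<lambda>n. cl q (if n = 0 then 1 else 0) (P_rep q n))"

context
  fixes q :: complex
  assumes q0: "q \<noteq> 0" and nru: "\<forall>n::nat. n > 0 \<longrightarrow> q ^ n \<noteq> 1"
begin

lemma is_P_plus: "is_P_plus q (P_plus q)"
  unfolding P_plus_def by (rule theI'[OF ex1_P_plus[OF q0 nru]])

lemma P_plus_rep: "P_plus q n = pres_cls (Uq_relations q) (P_rep q n)"
proof -
  have "P_plus q n \<in> carrier (Uq q)"
    using is_P_plus psi_subalg_commute(2) by (auto simp: is_P_plus_def)
  hence "\<exists>x. P_plus q n = pres_cls (Uq_relations q) x"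
    by (rule Uq_simps(1))
  thus ?thesis
    unfolding P_rep_def by (rule someI_ex)
qed

lemma pser_series:
  "E_plus_series q = pser q (E_ser q)" "psi_plus_series q = pser q (psi_ser q)" "P_plus q = pser q (P_ser q)"
  by (auto simp: pser_def E_ser_def psi_ser_def P_ser_def E_plus_series_def psi_plus_series_def
      Uq_E_def Uq_psi_plus_def proj_cl P_plus_rep)

lemma Uq_K_proj: "Uq_K q = proj q (cl q 1 (fpsi_plus 0))" "inv\<^bsub>Uq q\<^esub> Uq_K q = proj q (cl q 1 (fpsi_minus 0))"
  by (simp_all add: Uq_K_inv(1) proj_cl Uq_psi_minus_def) (simp add: Uq_K_def Uq_psi_plus_def)

text \<open>At \<open>q\<close> this is the defining equation of \<open>P_plus\<close>; for the
  other components it remains to track the scalars, which are 1 in degree 0 and 0 above on both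
  sides.\<close>

lemma P_ser_eq: "dil (inverse (q\<^sup>2)) (P_ser q) = fps_const (cl q 1 (fpsi_minus 0)) * psi_ser q * P_ser q"
  (is "_ = ?W")
proof (rule fps_ext)
  fix n
  have "pser q (dil (inverse (q\<^sup>2)) (P_ser q)) = zscale (Uq q) (q powi 2) (P_plus q)"
    using q0 by (simp add: pser_series zscale_pser)
  also have "\<dots> = pser q ?W"
    using is_P_plus by (simp add: is_P_plus_def Uq_K_proj(2) pser_series zmonom_proj pser_mult)
  finally have *: "proj q (dil (inverse (q\<^sup>2)) (P_ser q) $ n) = proj q (?W $ n)"
    by (simp add: pser_def fun_eq_iff)
  have "\<exists>x. ?W $ n = cl q (\<Sum>i=0..n. (if i = 0 then 1 else 0) * (if n - i = 0 then 1 else 0)) x"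
    unfolding fps_mult_nth[of "fps_const _ * _"]
    by (simp add: psi_ser_def P_ser_def cl_hom cl_sum) blast
  also have "(\<Sum>i=0..n. (if i = 0 then 1 else 0) * (if n - i = 0 then 1 else 0)) = (if n = 0 then 1 else (0::complex))"
    by (cases "n = 0") (auto intro!: sum.neutral)
  finally obtain x where x: "?W $ n = cl q (if n = 0 then 1 else 0) x" ..
  have y: "dil (inverse (q\<^sup>2)) (P_ser q) $ n = cl q (if n = 0 then 1 else 0) (scalar (inverse (q\<^sup>2) ^ n) * P_rep q n)"
    by (simp add: P_ser_def cl_hom)
  show "dil (inverse (q\<^sup>2)) (P_ser q) $ n = ?W $ n"
    using * unfolding x y proj_cl by (intro cl_eqI) simp_all
qed

lemma half_loop: "half_loop q (E_ser q) (psi_ser q) (P_ser q) (cl q 0 (fF 1)) (cl q 0 (fF 2))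
  (cl q 1 (fpsi_plus 0)) (cl q 1 (fpsi_minus 0))"
proof
  let ?K = "cl q 1 (fpsi_plus 0)" and ?Ki = "cl q 1 (fpsi_minus 0)"
  have powi: "q powi 2 = q\<^sup>2" "q powi (-2) = inverse (q\<^sup>2)"
    by (simp_all add: power_int_minus)
  note rel = Uq_rel[where q = q, unfolded powi]
  show "q \<noteq> 0" by (rule q0)
  show "\<And>n. 0 < n \<Longrightarrow> q ^ n \<noteq> 1" using nru by blast
  have "?K * ?Ki = cl q 1 1"
    unfolding cl_hom(3) by (rule cl_relI[OF rel(1)]) simp
  thus KKi: "?K * ?Ki = 1" by (simp only: cl_hom)
  have "?K * ?Ki = ?Ki * ?K"
    unfolding cl_hom(3) by (rule cl_relI[OF rel(3)]) simp
  from this[symmetric] KKi show KiK: "?Ki * ?K = 1" by (rule trans)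
  show "psi_ser q $ 0 = ?K" by (simp add: psi_ser_def)
  show "psi_ser q $ m * psi_ser q $ n = psi_ser q $ n * psi_ser q $ m" for m n
    unfolding psi_ser_def fps_nth_Abs_fps cl_hom(3) by (rule cl_relI[OF rel(2)]) simp
  show "P_ser q $ m * psi_ser q $ n = psi_ser q $ n * P_ser q $ m" for m n
    unfolding psi_ser_def P_ser_def fps_nth_Abs_fps cl_hom(3)
  proof (rule cl_eqI)
    have "P_plus q m \<in> psi_subalg q"
      using is_P_plus by (simp add: is_P_plus_def)
    from psi_subalg_commute(1)[OF this, of "int n"]
    show "pres_cls (Uq_relations q) (P_rep q m * fpsi_plus (int n)) = pres_cls (Uq_relations q) (fpsi_plus (int n) * P_rep q m)"
      by (simp add: P_plus_rep Uq_psi_plus_def Uq_simps)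
  qed simp
  \<comment> \<open>The defining relations conjugate by K; the locale wants them as
    q-commutation.\<close>
  have conj: "?K * x = c *\<^sub>C (x * ?K)" if "?K * x * ?Ki = c *\<^sub>C x" for x c
  proof -
    have "?K * x * (?Ki * ?K) = (c *\<^sub>C x) * ?K"
      by (simp only: that mult.assoc[symmetric])
    thus ?thesis by (simp add: KiK)
  qed
  show "?K * E_ser q $ n = q\<^sup>2 *\<^sub>C (E_ser q $ n * ?K)" for n
    by (rule conj) (simp add: E_ser_def cl_hom cl_relI[OF rel(4), of 0 0, OF refl])
  have F: "cl q 0 (fF j) * ?K = q\<^sup>2 *\<^sub>C (?K * cl q 0 (fF j))" for j
  proof -
    have "?K * cl q 0 (fF j) = inverse (q\<^sup>2) *\<^sub>C (cl q 0 (fF j) * ?K)"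
      by (rule conj) (simp add: cl_hom cl_relI[OF rel(5), of 0 0, OF refl])
    thus ?thesis using q0 by simp
  qed
  show "cl q 0 (fF 1) * ?K = q\<^sup>2 *\<^sub>C (?K * cl q 0 (fF 1))" "cl q 0 (fF 2) * ?K = q\<^sup>2 *\<^sub>C (?K * cl q 0 (fF 2))"
    by (rule F)+
  show "psi_ser q $ Suc k * E_ser q $ l - q\<^sup>2 *\<^sub>C (E_ser q $ l * psi_ser q $ Suc k)
      = q\<^sup>2 *\<^sub>C (psi_ser q $ k * E_ser q $ Suc l) - E_ser q $ Suc l * psi_ser q $ k" for k l
    using cl_relI[OF rel(6)[of "int k" "int l"], of 0 0, OF _ refl] by (simp add: psi_ser_def E_ser_def cl_hom add.commute)
  show "cl q 0 (fF 1) * psi_ser q $ Suc k - q\<^sup>2 *\<^sub>C (psi_ser q $ Suc k * cl q 0 (fF 1))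
      = q\<^sup>2 *\<^sub>C (cl q 0 (fF 2) * psi_ser q $ k) - psi_ser q $ k * cl q 0 (fF 2)" for k
  proof -
    have "psi_ser q $ Suc k * cl q 0 (fF 1) - inverse (q\<^sup>2) *\<^sub>C (cl q 0 (fF 1) * psi_ser q $ Suc k)
      = inverse (q\<^sup>2) *\<^sub>C (psi_ser q $ k * cl q 0 (fF 2)) - cl q 0 (fF 2) * psi_ser q $ k"
      using cl_relI[OF rel(7)[of "int k" 1], of 0 0, OF _ refl] by (simp add: psi_ser_def cl_hom add.commute)
    from arg_cong[OF this, of "\<lambda>x. (- (q\<^sup>2)) *\<^sub>C x"] show ?thesis
      using q0 by (simp add: calg.scale_right_diff_distrib)
  qed
  show "E_ser q $ Suc k * E_ser q $ l - q\<^sup>2 *\<^sub>C (E_ser q $ l * E_ser q $ Suc k)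
      = q\<^sup>2 *\<^sub>C (E_ser q $ k * E_ser q $ Suc l) - E_ser q $ Suc l * E_ser q $ k" for k l
    using cl_relI[OF rel(8)[of "int k" "int l"], of 0 0, OF refl] by (simp add: E_ser_def cl_hom add.commute)
  show "cl q 0 (fF 1) * cl q 0 (fF 2) = q\<^sup>2 *\<^sub>C (cl q 0 (fF 2) * cl q 0 (fF 1))"
  proof -
    let ?x = "cl q 0 (fF 2) * cl q 0 (fF 1)" and ?y = "inverse (q\<^sup>2) *\<^sub>C (cl q 0 (fF 1) * cl q 0 (fF 2))"
    \<comment> \<open>At k = l = 1 the quadratic relation of the F's is antisymmetric in this way,
      so it gives twice the claim.\<close>
    have "?x - ?y = ?y - ?x"
      using cl_relI[OF rel(9)[of 1 1], of 0 0, OF refl] by (simp add: cl_hom)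
    hence "(?x - ?y) + (?x - ?y) = (?x - ?y) + (?y - ?x)"
      by (rule arg_cong)
    hence "2 *\<^sub>C (?x - ?y) = 0"
      using calg.scale_left_distrib[of 1 1 "?x - ?y"] by simp
    hence "?x = ?y" by (simp only: calg.scale_eq_0_iff right_minus_eq) simp
    thus ?thesis using q0 by simp
  qed
  \<comment> \<open>The index \<open>Suc j\<close> makes the total degree positive, where psi^-
    vanishes.\<close>
  have E_F: "cl q 0 (fE (int k)) * cl q 0 (fF (int (Suc j))) - cl q 0 (fF (int (Suc j))) * cl q 0 (fE (int k))
      = (1 / (q - inverse q)) *\<^sub>C psi_ser q $ (k + Suc j)" for k j
    using cl_relI[OF rel(10)[of "int k" "int (Suc j)"], of 0 0, OF refl]
    by (simp add: psi_ser_def cl_hom fpsi_minus_def add_ac)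
  show "E_ser q $ k * cl q 0 (fF 1) - cl q 0 (fF 1) * E_ser q $ k = (1 / (q - inverse q)) *\<^sub>C psi_ser q $ Suc k" for k
    using E_F[of k 0] by (simp add: E_ser_def)
  show "E_ser q $ k * cl q 0 (fF 2) - cl q 0 (fF 2) * E_ser q $ k = (1 / (q - inverse q)) *\<^sub>C psi_ser q $ Suc (Suc k)" for k
    using E_F[of k 1] by (simp add: E_ser_def)
  have "P_ser q $ 0 = cl q 1 1"
    unfolding P_ser_def fps_nth_Abs_fps
  proof (rule cl_eqI)
    show "pres_cls (Uq_relations q) (P_rep q 0) = pres_cls (Uq_relations q) 1"
      using is_P_plus by (simp add: is_P_plus_def flip: P_plus_rep Uq_simps(4))
  qed simp
  thus "P_ser q $ 0 = 1" by (simp only: cl_hom)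
qed (rule P_ser_eq)

end

theorem proposition5p2:
  fixes q :: complex
  assumes "q \<noteq> 0"
    and "\<forall>n::nat. n > 0 \<longrightarrow> q ^ n \<noteq> 1"
  shows
    "series_sum (Uq q) (\<lambda>n.
       zmonom (Uq q)
         (((-1) ^ n * q ^ (n\<^sup>2)) \<odot>\<^bsub>Uq q\<^esub>
           (divpow q (Uq q) (Uq_E q 0) n \<otimes>\<^bsub>Uq q\<^esub> divpow q (Uq q) (Uq_F q 1) n
             \<otimes>\<^bsub>Uq q\<^esub> Uq_K q [^]\<^bsub>Uq q\<^esub> (- int n))) n)
   = series_sum (Uq q) (\<lambda>l.
       zmonom (Uq q) (((-1) ^ l * q ^ (l\<^sup>2)) \<odot>\<^bsub>Uq q\<^esub> (Uq_K q [^]\<^bsub>Uq q\<^esub> (- int l))) l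
       \<otimes>\<^bsub>Uq_series q\<^esub> zscale (Uq q) (q powi (-2 * int l)) (P_plus q)
       \<otimes>\<^bsub>Uq_series q\<^esub> divpow q (Uq_series q)
           (zmonom (Uq q) (Uq_F q 1) 0
              \<ominus>\<^bsub>Uq_series q\<^esub> zmonom (Uq q) (q powi (2 * int l + 2) \<odot>\<^bsub>Uq q\<^esub> Uq_F q 2) 1) l
       \<otimes>\<^bsub>Uq_series q\<^esub> divpow q (Uq_series q)
           (zscale (Uq q) (q powi (-2 * int l)) (E_plus_series q)) l)"
proof -
  define K Ki F1 F2 where "K = cl q 1 (fpsi_plus 0)" and "Ki = cl q 1 (fpsi_minus 0)"
    and "F1 = cl q 0 (fF 1)" and "F2 = cl q 0 (fF 2)"
  interpret half_loop q "E_ser q" "psi_ser q" "P_ser q" F1 F2 K Ki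
    unfolding K_def Ki_def F1_def F2_def by (rule half_loop[OF assms])
  interpret A: ring "Uq q" by (rule ring_Uq)
  have gens: "Uq_E q 0 = proj q (E_ser q $ 0)" "Uq_F q 1 = proj q F1" "Uq_F q 2 = proj q F2"
    by (simp_all add: Uq_E_def Uq_F_def E_ser_def F1_def F2_def proj_cl)
  have K_pow: "Uq_K q [^]\<^bsub>Uq q\<^esub> (- int n) = proj q (Ki ^ n)" for n
  proof -
    have comm: "K ^ n * Ki ^ n = 1" "Ki ^ n * K ^ n = 1"
      using left_right_inverse_power[of K Ki n] left_right_inverse_power[of Ki K n] by simp_all
    \<comment> \<open>A negative integer power is defined as the inverse of a natural power.\<close>
    have "inv\<^bsub>Uq q\<^esub> (proj q (K ^ n)) = proj q (Ki ^ n)"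
      by (rule A.inv_char) (simp_all add: comm flip: proj_hom)
    thus ?thesis
      by (cases "n = 0") (simp_all add: int_pow_def2 Uq_K_proj[OF assms] K_def[symmetric] proj_power proj_hom)
  qed
  have pw: "q powi (2 * int l + 2) = t ^ Suc l" "inverse (q powi (- 2 * int l)) = t ^ l" "q powi (- 2 * int l) \<noteq> 0" for l
  proof -
    have "q powi (2 * int l) = t ^ l" "q powi (2 * int l + 2) = q powi int (2 * Suc l)"
      using power_int_of_nat[of q "2 * l"] by (simp_all add: power_mult add_ac)
    thus "q powi (2 * int l + 2) = t ^ Suc l" "inverse (q powi (- 2 * int l)) = t ^ l" "q powi (- 2 * int l) \<noteq> 0"
      using q0 by (simp_all only: power_int_of_nat power_mult) (simp_all add: power_int_minus)
  qed
  have lhs: "zmonom (Uq q) (((-1) ^ n * q ^ (n\<^sup>2)) \<odot>\<^bsub>Uq q\<^esub>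
           (divpow q (Uq q) (Uq_E q 0) n \<otimes>\<^bsub>Uq q\<^esub> divpow q (Uq q) (Uq_F q 1) n
             \<otimes>\<^bsub>Uq q\<^esub> Uq_K q [^]\<^bsub>Uq q\<^esub> (- int n))) n
     = pser q (ups n (fps_const (rho n *\<^sub>C ((E_ser q $ 0) ^ n * F1 ^ n * Ki ^ n))))" for n
  proof -
    \<comment> \<open>Each divided power takes one of the two factorials in
      \<open>rho\<close>.\<close>
    have "rho n *\<^sub>C ((E_ser q $ 0) ^ n * F1 ^ n * Ki ^ n) = ((-1) ^ n * q ^ (n\<^sup>2)) *\<^sub>C
        ((1 / qfact q n) *\<^sub>C (E_ser q $ 0) ^ n * (1 / qfact q n) *\<^sub>C F1 ^ n * Ki ^ n)"
      by (simp add: rho_def power2_eq_square)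
    thus ?thesis
      by (simp only: gens divpow_proj K_pow proj_hom(5,6)[symmetric] zmonom_proj)
  qed
  have rhs: "zmonom (Uq q) (((-1) ^ l * q ^ (l\<^sup>2)) \<odot>\<^bsub>Uq q\<^esub> (Uq_K q [^]\<^bsub>Uq q\<^esub> (- int l))) l
       \<otimes>\<^bsub>Uq_series q\<^esub> zscale (Uq q) (q powi (-2 * int l)) (P_plus q)
       \<otimes>\<^bsub>Uq_series q\<^esub> divpow q (Uq_series q)
           (zmonom (Uq q) (Uq_F q 1) 0
              \<ominus>\<^bsub>Uq_series q\<^esub> zmonom (Uq q) (q powi (2 * int l + 2) \<odot>\<^bsub>Uq q\<^esub> Uq_F q 2) 1) l
       \<otimes>\<^bsub>Uq_series q\<^esub> divpow q (Uq_series q)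
           (zscale (Uq q) (q powi (-2 * int l)) (E_plus_series q)) l = pser q (R l)" for l
  proof -
    have u: "u (t ^ Suc l) = ups 0 (fps_const F1) - ups 1 (fps_const (t ^ Suc l *\<^sub>C F2))"
      by (simp add: u_def fps_const_scaleC del: power_Suc)
    have ki: "ki ^ l = fps_const (Ki ^ l)"
      by (simp add: fps_const_power)
    have "R l = ups l (fps_const (((-1) ^ l * q ^ (l\<^sup>2)) *\<^sub>C Ki ^ l)) * dil (t ^ l) (P_ser q)
        * (1 / qfact q l) *\<^sub>C u (t ^ Suc l) ^ l * (1 / qfact q l) *\<^sub>C dil (t ^ l) (E_ser q) ^ l"
      by (simp add: R_def rho_def ki mult.assoc power2_eq_square fps_const_scaleC[symmetric] del: power_Suc)
    thus ?thesis
      unfolding u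
      by (simp only: gens pser_series[OF assms] pw divpow_pser K_pow proj_hom(6)[symmetric] zmonom_proj
          zscale_pser[OF pw(3)] pser_minus pser_mult)
  qed
  show ?thesis
  proof
    fix n
    have "series_sum (Uq q) (\<lambda>l. pser q (ups l (fps_const (rho l *\<^sub>C ((E_ser q $ 0) ^ l * F1 ^ l * Ki ^ l))))) n
      = proj q (\<Sum>l\<le>n. ups l (fps_const (rho l *\<^sub>C ((E_ser q $ 0) ^ l * F1 ^ l * Ki ^ l))) $ n)"
      by (rule series_sum_pser) (simp add: ups_nth)
    \<comment> \<open>Each left-hand term is a monomial, so only l = n contributes.\<close>
    also have "(\<Sum>l\<le>n. ups l (fps_const (rho l *\<^sub>C ((E_ser q $ 0) ^ l * F1 ^ l * Ki ^ l))) $ n)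
      = (\<Sum>l\<le>n. if l = n then rho n *\<^sub>C ((E_ser q $ 0) ^ n * F1 ^ n * Ki ^ n) else 0)"
      by (intro sum.cong) (auto simp: ups_nth)
    also have "\<dots> = (\<Sum>l\<le>n. R l $ n)"
      by (simp add: divided_power_identity)
    also have "proj q \<dots> = series_sum (Uq q) (\<lambda>l. pser q (R l)) n"
      by (rule series_sum_pser[symmetric]) (rule R_nth)
    finally show "series_sum (Uq q) (\<lambda>n.
       zmonom (Uq q)
         (((-1) ^ n * q ^ (n\<^sup>2)) \<odot>\<^bsub>Uq q\<^esub>
           (divpow q (Uq q) (Uq_E q 0) n \<otimes>\<^bsub>Uq q\<^esub> divpow q (Uq q) (Uq_F q 1) n
             \<otimes>\<^bsub>Uq q\<^esub> Uq_K q [^]\<^bsub>Uq q\<^esub> (- int n))) n) n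
   = series_sum (Uq q) (\<lambda>l.
       zmonom (Uq q) (((-1) ^ l * q ^ (l\<^sup>2)) \<odot>\<^bsub>Uq q\<^esub> (Uq_K q [^]\<^bsub>Uq q\<^esub> (- int l))) l
       \<otimes>\<^bsub>Uq_series q\<^esub> zscale (Uq q) (q powi (-2 * int l)) (P_plus q)
       \<otimes>\<^bsub>Uq_series q\<^esub> divpow q (Uq_series q)
           (zmonom (Uq q) (Uq_F q 1) 0
              \<ominus>\<^bsub>Uq_series q\<^esub> zmonom (Uq q) (q powi (2 * int l + 2) \<odot>\<^bsub>Uq q\<^esub> Uq_F q 2) 1) l
       \<otimes>\<^bsub>Uq_series q\<^esub> divpow q (Uq_series q)
           (zscale (Uq q) (q powi (-2 * int l)) (E_plus_series q)) l) n"
      unfolding lhs rhs .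
  qed
qed

end
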